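(* Let $n\ge 2$, let $\phi_1,\dots,\phi_n:\mathbb{R}^{n-1}\to\mathbb{R}$ be smooth functions with associated Fourier extension operators $E_1,\dots,E_n$, and let $g_1,\dots,g_n\in L^1(\mathbb{R}^{n-1})$ be such that $$\det\begin{pmatrix}1&\cdots&1\\ \nabla\phi_1(\xi_1)&\cdots&\nabla\phi_n(\xi_n)\end{pmatrix}\neq 0$$ whenever $\xi_j$ belongs to the convex hull of the support of $g_j$ for each $1\le j\le n$. Then the $n$-fold convolution $|E_1g_1|^2*\cdots*|E_ng_n|^2$ is a constant function on $\mathbb{R}^n$, and at every point of $\mathbb{R}^n$ $$|E_1g_1|^2*\cdots*|E_ng_n|^2= (2\pi)^{n(n-1)}\int_{(\mathbb{R}^{n-1})^n}\frac{|g_1(\xi_1)|^2\cdots|g_n(\xi_n)|^2}{\left|\det\begin{pmatrix}1&\cdots&1\\ \nabla\phi_1(\xi_1)&\cdots&\nabla\phi_n(\xi_n)\end{pmatrix}\right|}\,d\xi_1\cdots d\xi_n .$$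
   Context: For a smooth $\phi:\mathbb{R}^{n-1}\to\mathbb{R}$, the associated Fourier extension operator is $Eg(x)=\int_{\mathbb{R}^{n-1}}e^{i(x'\cdot\xi+x_n\phi(\xi))}g(\xi)\,d\xi$ for $x=(x',x_n)\in\mathbb{R}^{n-1}\times\mathbb{R}$ and complex-valued $g\in L^1(\mathbb{R}^{n-1})$; $E_j$ is the operator associated with $\phi_j$. The matrix is the $n\times n$ matrix whose $j$-th column is $(1,\nabla\phi_j(\xi_j))^T$. The support of $g_j$ is its closed (essential) support. The convolution of nonnegative functions is $(F_1*\cdots*F_n)(y)=\int_{(\mathbb{R}^n)^{n-1}}F_1(x_1)\cdots F_{n-1}(x_{n-1})F_n(y-x_1-\cdots-x_{n-1})\,dx_1\cdots dx_{n-1}$. Both sides take values in $[0,\infty]$, and the identity is understood in $[0,\infty]$; the integrand on the right is taken to be $0$ where some $g_j(\xi_j)=0$. *)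

theory Defs
  imports "HOL-Analysis.Analysis"
begin

text \<open>
  Throughout, the index type \<open>'m\<close> has \<open>n - 1\<close> elements and \<open>'m option\<close> has \<open>n\<close> elements, so that
  letting \<open>'m\<close> range over all finite types is the same as letting \<open>n \<ge> 2\<close> be arbitrary.
  The index \<open>j = 1, \<dots>, n - 1\<close> is rendered as \<open>Some k\<close>, and the last index \<open>j = n\<close> as \<open>None\<close>.
  The space of points \<open>x = (x', x\<^sub>n)\<close> is \<open>(real ^ 'm) \<times> real\<close>.
\<close>

primrec times_cont_diff :: "nat \<Rightarrow> ('a::euclidean_space \<Rightarrow> real) \<Rightarrow> bool" where
  "times_cont_diff 0 f \<longleftrightarrow> continuous_on UNIV f"
| "times_cont_diff (Suc k) f \<longleftrightarrow>
     (\<forall>x. f differentiable (at x)) \<and>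
     (\<forall>v. times_cont_diff k (\<lambda>x. frechet_derivative f (at x) v))"

definition smooth :: "('a::euclidean_space \<Rightarrow> real) \<Rightarrow> bool" where
  "smooth f \<longleftrightarrow> (\<forall>k. times_cont_diff k f)"

definition gradient :: "(real ^ 'm \<Rightarrow> real) \<Rightarrow> real ^ 'm \<Rightarrow> real ^ 'm" where
  "gradient f x = (\<chi> k. frechet_derivative f (at x) (axis k 1))"

definition extension_operator ::
    "(real ^ 'm \<Rightarrow> real) \<Rightarrow> (real ^ 'm \<Rightarrow> complex) \<Rightarrow> (real ^ 'm) \<times> real \<Rightarrow> complex" where
  "extension_operator \<phi> g x =
     (LINT \<xi>|lebesgue. exp (\<i> * complex_of_real (fst x \<bullet> \<xi> + snd x * \<phi> \<xi>)) * g \<xi>)"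

text \<open>The complement of the largest open set on which \<open>g\<close> vanishes almost everywhere.\<close>

definition ess_support :: "('a::euclidean_space \<Rightarrow> complex) \<Rightarrow> 'a set" where
  "ess_support g = - \<Union>{U. open U \<and> (AE x in lebesgue. x \<in> U \<longrightarrow> g x = 0)}"

text \<open>Row \<open>None\<close> is the row of ones; column \<open>j\<close> is \<open>(1, \<nabla>\<phi>\<^sub>j(\<xi>\<^sub>j))\<^sup>T\<close>. Placing the index \<open>None\<close> first
  for rows and last for columns affects the determinant at most by a sign.\<close>

definition gradient_matrix ::
    "('m option \<Rightarrow> real ^ 'm \<Rightarrow> real) \<Rightarrow> ('m option \<Rightarrow> real ^ 'm) \<Rightarrow>
     real ^ ('m::finite option) ^ ('m option)" where
  "gradient_matrix \<phi> \<xi> =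
     (\<chi> i j. case i of None \<Rightarrow> 1 | Some k \<Rightarrow> gradient (\<phi> j) (\<xi> j) $ k)"

text \<open>The integration variables \<open>x\<^sub>1, \<dots>, x\<^sub>n\<^sub>-\<^sub>1\<close> are indexed by \<open>'m\<close>; the last factor is \<open>F None\<close>.\<close>

definition nfold_convolution ::
    "('m::finite option \<Rightarrow> 'a::euclidean_space \<Rightarrow> ennreal) \<Rightarrow> 'a \<Rightarrow> ennreal" where
  "nfold_convolution F y =
     (\<integral>\<^sup>+ x. (\<Prod>k\<in>UNIV. F (Some k) (x k)) * F None (y - (\<Sum>k\<in>UNIV. x k))
        \<partial>(\<Pi>\<^sub>M k\<in>(UNIV :: 'm set). lebesgue))"

end

theory Submission
  imports Defs "HOL-Probability.Characteristic_Functions"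
begin

text \<open>
  Writing \<open>x\<^sub>n = y - x\<^sub>1 - \<dots> - x\<^sub>n\<^sub>-\<^sub>1\<close>, the product of the extensions at \<open>x\<^sub>1, \<dots>, x\<^sub>n\<close> is, up to a
  unimodular factor inside the integral, the Fourier transform at \<open>(x\<^sub>1, \<dots>, x\<^sub>n\<^sub>-\<^sub>1)\<close> of the image of
  \<open>g\<^sub>1 \<otimes> \<dots> \<otimes> g\<^sub>n\<close> under \<open>\<xi> \<mapsto> (\<xi>\<^sub>k - \<xi>\<^sub>n, \<phi>\<^sub>k(\<xi>\<^sub>k) - \<phi>\<^sub>n(\<xi>\<^sub>n))\<^sub>k\<^sub><\<^sub>n\<close>. Both spaces have dimension
  \<open>n(n - 1)\<close>, the map is injective on the product of the convex hulls of the supports by the mean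
  value theorem, and its Jacobian is the gradient determinant up to sign, so the identity is Plancherel's.
  Plancherel is applied first in \<open>\<eta>\<^sub>k = \<xi>\<^sub>k - \<xi>\<^sub>n\<close> and then, for fixed \<open>\<eta>\<close>, in the remaining \<open>n - 1\<close>
  variables \<open>v = \<xi>\<^sub>n\<close>, so that only an \<open>(n - 1)\<close>-dimensional change of variables is needed.
\<close>

text \<open>The functions \<open>g\<^sub>j\<close> are merely integrable, so either side may be
  infinite and no L^2 theory is available. Plancherel is therefore proved for integrable functions
  as an identity in [0, \<infinity>]; it then applies at each fixed vector \<open>T\<close> of last
  coordinates and at almost every \<open>\<eta>\<close>, and Tonelli allows every exchange of
  integrals of squared moduli. The point \<open>y\<close> occurs only in the unimodular factor,
  which the modulus removes: this is the source of the constancy. Convex hulls enter because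
  injectivity is tested at mean value points on segments between frequencies, and these points
  differ from index to index. Freezing \<open>\<eta>\<close> makes two frequency tuples differ by
  one common vector, so that the n mean value equations form a single linear system with a gradient
  matrix. The exponent n(n - 1) is (n - 1)^2 from the spatial variables plus n - 1 from
  \<open>T\<close>.\<close>

subsection \<open>Preliminaries and continuity of translations\<close>

text \<open>The change of variables theorem of the library demands a well-ordered index type.\<close>

datatype 'a wellordered = WO (un_WO: 'a)

instance wellordered :: (finite) finite
proof
  have *: "(UNIV :: 'a wellordered set) = WO ` (UNIV :: 'a set)"
    by (metis surj_def wellordered.exhaust)
  show "finite (UNIV :: 'a wellordered set)"
    unfolding * by (rule finite_imageI) simp
qed

instantiation wellordered :: (finite) wellorder
begin

definition less_eq_wellordered :: "'a wellordered \<Rightarrow> 'a wellordered \<Rightarrow> bool" where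
  "less_eq_wellordered x y \<longleftrightarrow> to_nat_on UNIV (un_WO x) \<le> to_nat_on UNIV (un_WO y)"

definition less_wellordered :: "'a wellordered \<Rightarrow> 'a wellordered \<Rightarrow> bool" where
  "less_wellordered x y \<longleftrightarrow> to_nat_on UNIV (un_WO x) < to_nat_on UNIV (un_WO y)"

instance
proof
  fix x y :: "'a wellordered"
  assume "x \<le> y" "y \<le> x"
  then show "x = y"
    by (auto simp: less_eq_wellordered_def uncountable_infinite intro!: wellordered.expand)
next
  fix P :: "'a wellordered \<Rightarrow> bool" and a :: "'a wellordered"
  assume *: "\<And>x. (\<And>y. y < x \<Longrightarrow> P y) \<Longrightarrow> P x"
  show "P a"
    by (induction a rule: measure_induct_rule[where f = "\<lambda>x. to_nat_on UNIV (un_WO x)"])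
       (rule *, simp add: less_wellordered_def)
qed (auto simp: less_eq_wellordered_def less_wellordered_def)

end

section \<open>Continuity of translations in L^1\<close>

lemma nn_integral_lborel_translate:
  fixes f :: "'a::euclidean_space \<Rightarrow> ennreal"
  assumes [measurable]: "f \<in> borel_measurable borel"
  shows "(\<integral>\<^sup>+x. f (x + z) \<partial>lborel) = (\<integral>\<^sup>+x. f x \<partial>lborel)"
  by (subst (2) lborel_distr_plus[of z, symmetric]) (simp add: nn_integral_distr add.commute)

lemma integral_lborel_translate:
  fixes f :: "'a::euclidean_space \<Rightarrow> 'b::{banach,second_countable_topology}"
  assumes [measurable]: "f \<in> borel_measurable borel"
  shows "(\<integral>x. f (x + z) \<partial>lborel) = (\<integral>x. f x \<partial>lborel)"
  by (subst (2) lborel_distr_plus[of z, symmetric]) (simp add: integral_distr add.commute)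

lemma integrable_lborel_translate:
  fixes f :: "'a::euclidean_space \<Rightarrow> 'b::{banach,second_countable_topology}"
  assumes "integrable lborel f"
  shows "integrable lborel (\<lambda>x. f (x + z))"
proof -
  have [measurable]: "f \<in> borel_measurable borel"
    using assms by auto
  have "integrable (distr lborel borel ((+) z)) f"
    using assms by (simp add: lborel_distr_plus)
  then show ?thesis
    by (subst (asm) integrable_distr_eq) (auto simp: add.commute)
qed

text \<open>The L^1 modulus of continuity. It controls the error made when a Gaussian average
  replaces evaluation at a point, in \<open>gauss_approx_identity\<close>.\<close>

definition L1_translation :: "('a::euclidean_space \<Rightarrow> 'b::{banach,second_countable_topology}) \<Rightarrow> 'a \<Rightarrow> real" where
  "L1_translation h z = (\<integral>x. norm (h (x + z) - h x) \<partial>lborel)"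

lemma L1_translation_bound:
  fixes h :: "'a::euclidean_space \<Rightarrow> 'b::{banach,second_countable_topology}"
  assumes "integrable lborel h"
  shows "0 \<le> L1_translation h z" "L1_translation h z \<le> 2 * (\<integral>x. norm (h x) \<partial>lborel)"
proof -
  show "0 \<le> L1_translation h z"
    unfolding L1_translation_def by simp
  note i = assms integrable_lborel_translate[OF assms, of z]
  have "L1_translation h z \<le> (\<integral>x. norm (h (x + z)) + norm (h x) \<partial>lborel)"
    unfolding L1_translation_def using i
    by (intro integral_mono) (auto intro: norm_triangle_ineq4)
  also have "\<dots> = 2 * (\<integral>x. norm (h x) \<partial>lborel)"
    using i integral_lborel_translate[of "\<lambda>x. norm (h x)" z] by auto
  finally show "L1_translation h z \<le> 2 * (\<integral>x. norm (h x) \<partial>lborel)" .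
qed

text \<open>Split \<open>h\<close> into \<open>k\<close> and a remainder. The remainder is counted
  once at the shifted and once at the original point, whence the factor 2.\<close>

lemma L1_translation_le:
  fixes h k :: "'a::euclidean_space \<Rightarrow> 'b::{banach,second_countable_topology}"
  assumes "integrable lborel h" "integrable lborel k"
  shows "L1_translation h z \<le> L1_translation k z + 2 * (\<integral>x. norm (h x - k x) \<partial>lborel)"
proof -
  note i = assms assms[THEN integrable_lborel_translate, of z]
  have d: "integrable lborel (\<lambda>x. h x - k x)" using i by auto
  have "L1_translation h z \<le> (\<integral>x. norm (k (x + z) - k x) + norm ((h (x + z) - k (x + z)) - (h x - k x)) \<partial>lborel)"
    unfolding L1_translation_def
    by (rule integral_mono)
       (use i in \<open>auto intro!: order_trans[OF _ norm_triangle_ineq] simp: algebra_simps\<close>)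
  also have "\<dots> = L1_translation k z + L1_translation (\<lambda>x. h x - k x) z"
    unfolding L1_translation_def using i by (subst Bochner_Integration.integral_add) auto
  finally show ?thesis
    using L1_translation_bound(2)[OF d, of z] by simp
qed

lemma L1_translation_add_le:
  fixes h k :: "'a::euclidean_space \<Rightarrow> 'b::{banach,second_countable_topology}"
  assumes "integrable lborel h" "integrable lborel k"
  shows "L1_translation (\<lambda>x. h x + k x) z \<le> L1_translation h z + L1_translation k z"
proof -
  note i = assms assms[THEN integrable_lborel_translate, of z]
  have "L1_translation (\<lambda>x. h x + k x) z \<le> (\<integral>x. norm (h (x + z) - h x) + norm (k (x + z) - k x) \<partial>lborel)"
    unfolding L1_translation_def
    by (rule integral_mono)
       (use i in \<open>auto intro!: order_trans[OF _ norm_triangle_ineq] simp: algebra_simps\<close>)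
  also have "\<dots> = L1_translation h z + L1_translation k z"
    unfolding L1_translation_def using i by (subst Bochner_Integration.integral_add) auto
  finally show ?thesis .
qed

text \<open>By \<open>L1_translation_le\<close> the cost of replacing \<open>h\<close> by
  \<open>k\<close> does not depend on the shift, so continuity passes to L^1 limits.\<close>

lemma tendsto_L1_translation_approx:
  fixes h :: "'a::euclidean_space \<Rightarrow> 'b::{banach,second_countable_topology}"
  assumes h: "integrable lborel h"
    and approx: "\<And>e. e > 0 \<Longrightarrow> \<exists>k. integrable lborel k \<and> (\<integral>x. norm (h x - k x) \<partial>lborel) < e \<and>
      (\<lambda>n. L1_translation k (z n)) \<longlonglongrightarrow> 0"
  shows "(\<lambda>n. L1_translation h (z n)) \<longlonglongrightarrow> 0"
proof (rule order_tendstoI)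
  fix a :: real assume "a < 0"
  then show "\<forall>\<^sub>F n in sequentially. a < L1_translation h (z n)"
    using L1_translation_bound(1)[OF h] by (intro always_eventually) (meson less_le_trans)
next
  fix a :: real assume "0 < a"
  \<comment> \<open>Twice an error below \<open>a / 4\<close> uses up half of \<open>a\<close>; the
    other half is left for the translation of \<open>k\<close>.\<close>
  then obtain k where k: "integrable lborel k" "(\<integral>x. norm (h x - k x) \<partial>lborel) < a / 4"
    "(\<lambda>n. L1_translation k (z n)) \<longlonglongrightarrow> 0"
    using approx[of "a / 4"] by auto
  have "\<forall>\<^sub>F n in sequentially. L1_translation k (z n) < a / 2"
    using k(3) \<open>0 < a\<close> by (intro order_tendstoD(2)) auto
  then show "\<forall>\<^sub>F n in sequentially. L1_translation h (z n) < a"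
  proof eventually_elim
    case (elim n)
    then show ?case
      using L1_translation_le[OF h k(1), of "z n"] k(2) by linarith
  qed
qed

text \<open>The symmetric difference of \<open>U\<close> and its translate has measure twice that of
  \<open>U\<close> minus twice the overlap. The overlap converges by dominated convergence: openness
  gives pointwise convergence on \<open>U\<close>, and off \<open>U\<close>, boundary included, the
  product of the indicators is 0.\<close>

lemma tendsto_L1_translation_open:
  fixes U :: "'a::euclidean_space set" and c :: "'b::{banach,second_countable_topology}"
  assumes "open U" and fin: "emeasure lborel U < \<infinity>" and z: "z \<longlonglongrightarrow> 0"
  shows "(\<lambda>n. L1_translation (\<lambda>x. indicator U x *\<^sub>R c) (z n)) \<longlonglongrightarrow> 0"
proof -
  let ?i = "indicator U :: 'a \<Rightarrow> real"
  have [measurable]: "U \<in> sets borel"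
    using \<open>open U\<close> by simp
  have iU: "integrable lborel ?i"
    using fin by (simp add: integrable_indicator_iff)
  have iUz: "integrable lborel (\<lambda>x. ?i (x + w))" for w
    by (rule integrable_lborel_translate[OF iU])
  have iUU: "integrable lborel (\<lambda>x. ?i (x + w) * ?i x)" for w
    by (rule Bochner_Integration.integrable_bound[OF iU]) (auto simp: indicator_def)
  have eq: "L1_translation (\<lambda>x. indicator U x *\<^sub>R c) w =
      (2 * measure lborel U - 2 * (\<integral>x. ?i (x + w) * ?i x \<partial>lborel)) * norm c" for w
  proof -
    have "L1_translation (\<lambda>x. indicator U x *\<^sub>R c) w
        = (\<integral>x. (?i (x + w) + ?i x - 2 * (?i (x + w) * ?i x)) * norm c \<partial>lborel)"
      unfolding L1_translation_def
      by (intro Bochner_Integration.integral_cong) (auto simp: indicator_def)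
    also have "\<dots> = ((\<integral>x. ?i (x + w) \<partial>lborel) + (\<integral>x. ?i x \<partial>lborel) - 2 * (\<integral>x. ?i (x + w) * ?i x \<partial>lborel)) * norm c"
      using iU iUz iUU by simp
    finally show ?thesis
      using integral_lborel_translate[of ?i w] by simp
  qed
  have "(\<lambda>n. \<integral>x. ?i (x + z n) * ?i x \<partial>lborel) \<longlonglongrightarrow> (\<integral>x. ?i x \<partial>lborel)"
  proof (rule integral_dominated_convergence[where w = ?i])
    show "AE x in lborel. (\<lambda>n. ?i (x + z n) * ?i x) \<longlonglongrightarrow> ?i x"
    proof (intro always_eventually allI)
      fix x
      show "(\<lambda>n. ?i (x + z n) * ?i x) \<longlonglongrightarrow> ?i x"
      proof (cases "x \<in> U")
        case True
        have "(\<lambda>n. x + z n) \<longlonglongrightarrow> x"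
          using tendsto_add[OF tendsto_const z, of x] by simp
        then have "\<forall>\<^sub>F n in sequentially. x + z n \<in> U"
          using \<open>open U\<close> True by (rule topological_tendstoD)
        then have "\<forall>\<^sub>F n in sequentially. ?i (x + z n) * ?i x = ?i x"
          by eventually_elim (simp add: True)
        then show ?thesis by (rule tendsto_eventually)
      qed simp
    qed
  qed (auto simp: indicator_def iU[unfolded indicator_def] intro!: iU)
  then have "(\<lambda>n. (2 * measure lborel U - 2 * (\<integral>x. ?i (x + z n) * ?i x \<partial>lborel)) * norm c)
      \<longlonglongrightarrow> (2 * measure lborel U - 2 * (\<integral>x. ?i x \<partial>lborel)) * norm c"
    by (intro tendsto_intros)
  then show ?thesis by (simp add: eq)
qed

text \<open>Outer regularity passes from open sets to Borel sets of finite measure, and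
  \<open>integrable_induct\<close> from there to all integrable functions.\<close>

lemma tendsto_L1_translation:
  fixes h :: "'a::euclidean_space \<Rightarrow> 'b::{banach,second_countable_topology}"
  assumes "integrable lborel h" and z: "z \<longlonglongrightarrow> 0"
  shows "(\<lambda>n. L1_translation h (z n)) \<longlonglongrightarrow> 0"
  using assms(1)
proof (induction rule: integrable_induct)
  case (base A c)
  then have [measurable]: "A \<in> sets borel" by simp
  have iA: "integrable lborel (\<lambda>x. indicator A x *\<^sub>R c)"
    using base by (intro integrable_scaleR_left) (simp add: integrable_indicator_iff)
  show ?case
  proof (rule tendsto_L1_translation_approx[OF iA])
    fix e :: real assume e: "e > 0"
    \<comment> \<open>Adding 1 covers \<open>c = 0\<close> and makes the final estimate
      strict.\<close>
    then have e': "e / (norm c + 1) > 0" by (simp add: add_nonneg_pos)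
    obtain U where U: "open U" "A \<subseteq> U" "emeasure lborel (U - A) < e / (norm c + 1)"
      using outer_regular_lborel[OF _ e', of A] base by auto
    have [measurable]: "U \<in> sets borel" using U(1) by simp
    have finD: "emeasure lborel (U - A) < \<infinity>"
      using U(3) by (rule less_trans) simp
    have "emeasure lborel U = emeasure lborel A + emeasure lborel (U - A)"
      using U(2) by (subst plus_emeasure) (auto simp: Un_absorb1)
    then have finU: "emeasure lborel U < \<infinity>"
      using finD base by (simp add: ennreal_add_less_top)
    have "(\<integral>x. norm (indicator A x *\<^sub>R c - indicator U x *\<^sub>R c) \<partial>lborel) =
       (\<integral>x. indicator (U - A) x * norm c \<partial>lborel)"
      using U(2) by (intro Bochner_Integration.integral_cong) (auto simp: indicator_def)
    also have "\<dots> = measure lborel (U - A) * norm c"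
      by simp
    also have "\<dots> \<le> e / (norm c + 1) * norm c"
    proof (rule mult_right_mono)
      have "ennreal (measure lborel (U - A)) < ennreal (e / (norm c + 1))"
        using U(3) finD by (simp add: emeasure_eq_ennreal_measure[symmetric])
      then show "measure lborel (U - A) \<le> e / (norm c + 1)"
        using e' by (simp add: ennreal_less_iff)
    qed simp
    also have "\<dots> < e"
      using mult_strict_left_mono[of "norm c" "norm c + 1", OF _ e'] add_nonneg_pos[of "norm c" 1] by simp
    finally show "\<exists>k. integrable lborel k \<and> (\<integral>x. norm (indicator A x *\<^sub>R c - k x) \<partial>lborel) < e \<and>
      (\<lambda>n. L1_translation k (z n)) \<longlonglongrightarrow> 0"
      using tendsto_L1_translation_open[OF U(1) finU z, of c] finU
      by (intro exI[of _ "\<lambda>x. indicator U x *\<^sub>R c"] conjI integrable_scaleR_left)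
         (auto simp: integrable_indicator_iff)
  qed
next
  case (add f g)
  show ?case
  proof (rule tendsto_sandwich[OF always_eventually always_eventually])
    show "\<forall>n. 0 \<le> L1_translation (\<lambda>x. f x + g x) (z n)"
      using add by (intro allI L1_translation_bound) auto
    show "\<forall>n. L1_translation (\<lambda>x. f x + g x) (z n) \<le> L1_translation f (z n) + L1_translation g (z n)"
      using add by (intro allI L1_translation_add_le) auto
    show "(\<lambda>n. L1_translation f (z n) + L1_translation g (z n)) \<longlonglongrightarrow> 0"
      using tendsto_add[OF add(3,4)] add by (simp add: tendsto_add_zero)
  qed simp
next
  case (lim f s)
  show ?case
  proof (rule tendsto_L1_translation_approx)
    fix e :: real assume e: "e > 0"
    have [measurable]: "\<And>i. s i \<in> borel_measurable borel" "f \<in> borel_measurable borel"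
      using lim by (auto dest: borel_measurable_integrable)
    have bound: "norm (s i x) \<le> 2 * norm (f x)" for i x
      using lim.hyps by simp
    \<comment> \<open>The approximants satisfy \<open>norm (s i x) \<le> 2 * norm (f x)\<close>,
      which gives the majorant with factor 3.\<close>
    have "(\<lambda>i. \<integral>x. norm (f x - s i x) \<partial>lborel) \<longlonglongrightarrow> (\<integral>x. norm (f x - f x) \<partial>lborel)"
    proof (rule integral_dominated_convergence[where w = "\<lambda>x. 3 * norm (f x)"])
      show "AE x in lborel. norm (norm (f x - s i x)) \<le> 3 * norm (f x)" for i
      proof (intro always_eventually allI)
        fix x show "norm (norm (f x - s i x)) \<le> 3 * norm (f x)"
          using bound[of i x] norm_triangle_ineq4[of "f x" "s i x"] by simp
      qed
      show "AE x in lborel. (\<lambda>i. norm (f x - s i x)) \<longlonglongrightarrow> norm (f x - f x)"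
        using lim.hyps by (intro always_eventually allI tendsto_intros) simp
    qed (use lim in auto)
    then have "\<forall>\<^sub>F i in sequentially. (\<integral>x. norm (f x - s i x) \<partial>lborel) < e"
      using e by (intro order_tendstoD(2)) auto
    then obtain i where "(\<integral>x. norm (f x - s i x) \<partial>lborel) < e"
      by (auto simp: eventually_sequentially)
    then show "\<exists>k. integrable lborel k \<and> (\<integral>x. norm (f x - k x) \<partial>lborel) < e \<and>
      (\<lambda>n. L1_translation k (z n)) \<longlonglongrightarrow> 0"
      using lim by (intro exI[of _ "s i"]) auto
  qed (fact lim)
qed

subsection \<open>Gaussian weights\<close>

lemma
  fixes f :: "'a::euclidean_space \<Rightarrow> real \<Rightarrow> 'b::{real_normed_field,banach,second_countable_topology}"
  assumes f: "\<And>b. b \<in> Basis \<Longrightarrow> integrable lborel (f b)"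
  shows integrable_lborel_prod: "integrable lborel (\<lambda>x::'a. \<Prod>b\<in>Basis. f b (x \<bullet> b))"
    and integral_lborel_prod: "(\<integral>x. (\<Prod>b\<in>Basis. f b (x \<bullet> b)) \<partial>lborel) = (\<Prod>b\<in>Basis. \<integral>x. f b x \<partial>lborel)"
proof -
  interpret product_sigma_finite "\<lambda>_::'a. lborel :: real measure" ..
  have [measurable]: "\<And>b. b \<in> Basis \<Longrightarrow> f b \<in> borel_measurable borel"
    using f by (auto dest: borel_measurable_integrable)
  have inner: "(\<Sum>b'\<in>Basis. x b' *\<^sub>R b') \<bullet> b = x b" if "b \<in> Basis" for x and b :: 'a
    using that by simp
  have eq: "(\<Prod>b\<in>Basis. f b ((\<Sum>b'\<in>Basis. x b' *\<^sub>R b') \<bullet> b)) = (\<Prod>b\<in>Basis. f b (x b))" for x :: "'a \<Rightarrow> real"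
    by (intro prod.cong) (simp_all only: inner)
  show "integrable lborel (\<lambda>x::'a. \<Prod>b\<in>Basis. f b (x \<bullet> b))"
    unfolding lborel_eq[where 'a = 'a]
    by (subst integrable_distr_eq) (simp_all add: eq product_integrable_prod f del: inner_sum_left_Basis)
  show "(\<integral>x. (\<Prod>b\<in>Basis. f b (x \<bullet> b)) \<partial>lborel) = (\<Prod>b\<in>Basis. \<integral>x. f b x \<partial>lborel)"
    unfolding lborel_eq[where 'a = 'a]
    by (subst integral_distr) (simp_all add: eq product_integral_prod f del: inner_sum_left_Basis)
qed

lemma integral_lborel_scale:
  fixes f :: "'a::euclidean_space \<Rightarrow> real"
  assumes [measurable]: "f \<in> borel_measurable borel" and "0 < c"
  shows "(\<integral>x. f x \<partial>lborel) = c ^ DIM('a) * (\<integral>x. f (c *\<^sub>R x) \<partial>lborel)"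
  using assms(2)
  by (subst lborel_affine[of c 0]) (simp_all add: integral_density integral_distr)

text \<open>This is exp(-e^2 |x|^2 / 2), kept as a product over \<open>Basis\<close> so that
  one-dimensional integrals multiply up. It tends to 1 as \<open>e\<close> tends to 0.\<close>

definition gauss_weight :: "real \<Rightarrow> 'a::euclidean_space \<Rightarrow> real" where
  "gauss_weight e x = (\<Prod>b\<in>Basis. exp (- (e * (x \<bullet> b))\<^sup>2 / 2))"

text \<open>The density of independent centred normal coordinates with standard deviation
  \<open>e\<close>; up to a constant, the Fourier transform of
  \<open>gauss_weight e\<close>.\<close>

definition gauss_kernel :: "real \<Rightarrow> 'a::euclidean_space \<Rightarrow> real" where
  "gauss_kernel e u = (\<Prod>b\<in>Basis. normal_density 0 e (u \<bullet> b))"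

lemma borel_measurable_gauss [measurable]:
  "gauss_weight e \<in> borel_measurable borel" "gauss_kernel e \<in> borel_measurable borel"
  unfolding gauss_weight_def gauss_kernel_def by measurable

lemma gauss_nonneg [simp]: "0 \<le> gauss_weight e x" "0 \<le> gauss_kernel e x"
  by (simp_all add: gauss_weight_def gauss_kernel_def prod_nonneg)

lemma gauss_weight_le_1: "gauss_weight e x \<le> 1"
  unfolding gauss_weight_def by (rule prod_le_1) simp

lemma gauss_kernel_le: "gauss_kernel e (x :: 'a::euclidean_space) \<le> normal_density 0 e 0 ^ DIM('a)"
proof -
  have "gauss_kernel e x \<le> (\<Prod>b\<in>(Basis::'a set). normal_density 0 e 0)"
    unfolding gauss_kernel_def
    by (intro prod_mono) (auto simp: normal_density_def divide_right_mono)
  then show ?thesis by simp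
qed

text \<open>Rescaling turns integration against a narrowing kernel into integration against a fixed
  one, the form needed for dominated convergence.\<close>

lemma gauss_kernel_scale:
  fixes x :: "'a::euclidean_space"
  assumes "0 < e"
  shows "e ^ DIM('a) * gauss_kernel e (e *\<^sub>R x) = gauss_kernel 1 x"
proof -
  have "e * normal_density 0 e (e * t) = normal_density 0 1 t" for t
    using assms by (simp add: normal_density_def real_sqrt_mult power_mult_distrib field_simps)
  then have "(\<Prod>b\<in>(Basis::'a set). e * normal_density 0 e ((e *\<^sub>R x) \<bullet> b)) = gauss_kernel 1 x"
    by (simp add: gauss_kernel_def)
  then show ?thesis
    by (simp add: prod.distrib gauss_kernel_def)
qed

lemma integrable_gauss_kernel: "0 < e \<Longrightarrow> integrable lborel (gauss_kernel e)"
  unfolding gauss_kernel_def by (rule integrable_lborel_prod) simp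

lemma integral_gauss_kernel: "0 < e \<Longrightarrow> (\<integral>x. gauss_kernel e x \<partial>lborel) = 1"
  unfolding gauss_kernel_def by (subst integral_lborel_prod) simp_all

lemma nn_integral_gauss_kernel: "0 < e \<Longrightarrow> (\<integral>\<^sup>+x. ennreal (gauss_kernel e x) \<partial>lborel) = 1"
  by (subst nn_integral_eq_integral) (simp_all add: integral_gauss_kernel integrable_gauss_kernel)

text \<open>This is the characteristic function of the standard normal distribution, rescaled by
  \<open>e\<close>. One factor \<open>sqrt (2 * pi)\<close> comes from normalising the weight to a
  density, the other from writing the result as a normal density.\<close>

lemma gauss_fourier_1:
  assumes e: "0 < e"
  shows "integrable lborel (\<lambda>x. cis (x * t) * complex_of_real (exp (- (e * x)\<^sup>2 / 2)))"
    and "(\<integral>x. cis (x * t) * complex_of_real (exp (- (e * x)\<^sup>2 / 2)) \<partial>lborel) = complex_of_real (2 * pi * normal_density 0 e t)"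
proof -
  have eqd: "exp (- (y\<^sup>2 / 2)) = sqrt (2 * pi) * std_normal_density y" for y
    by (simp add: normal_density_def)
  have base: "integrable lborel (\<lambda>x. cis (x * s) * complex_of_real (exp (- x\<^sup>2 / 2)))" for s
  proof (rule Bochner_Integration.integrable_bound)
    show "integrable lborel (\<lambda>x. sqrt (2 * pi) * std_normal_density x)" by simp
    show "(\<lambda>x. cis (x * s) * complex_of_real (exp (- x\<^sup>2 / 2))) \<in> borel_measurable lborel"
      unfolding cis_conv_exp by measurable
  qed (simp add: norm_mult eqd abs_mult)
  have val: "(\<integral>x. cis (x * s) * complex_of_real (exp (- x\<^sup>2 / 2)) \<partial>lborel) = sqrt (2 * pi) * exp (- s\<^sup>2 / 2)" for s
  proof -
    have "(\<integral>x. cis (x * s) * complex_of_real (exp (- x\<^sup>2 / 2)) \<partial>lborel)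
      = (\<integral>x. complex_of_real (sqrt (2 * pi)) * (std_normal_density x *\<^sub>R iexp (s * x)) \<partial>lborel)"
      by (intro Bochner_Integration.integral_cong) (simp_all add: eqd cis_conv_exp scaleR_conv_of_real algebra_simps)
    also have "\<dots> = sqrt (2 * pi) * (\<integral>x. std_normal_density x *\<^sub>R iexp (s * x) \<partial>lborel)"
      by (rule integral_mult_right_zero)
    also have "(\<integral>x. std_normal_density x *\<^sub>R iexp (s * x) \<partial>lborel) = char std_normal_distribution s"
      unfolding char_def by (subst integral_density) (simp_all add: mult.commute)
    finally show ?thesis
      by (simp add: char_std_normal_distribution)
  qed
  let ?f = "\<lambda>x. cis (x * (t / e)) * complex_of_real (exp (- x\<^sup>2 / 2))"
  have f: "?f (0 + e * x) = cis (x * t) * complex_of_real (exp (- (e * x)\<^sup>2 / 2))" for x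
    using e by simp
  show "integrable lborel (\<lambda>x. cis (x * t) * complex_of_real (exp (- (e * x)\<^sup>2 / 2)))"
    using lborel_integrable_real_affine[OF base[of "t / e"], of e 0] e unfolding f by simp
  have "complex_of_real (sqrt (2 * pi) * exp (- (t / e)\<^sup>2 / 2))
      = e *\<^sub>R (\<integral>x. cis (x * t) * complex_of_real (exp (- (e * x)\<^sup>2 / 2)) \<partial>lborel)"
    using lborel_integral_real_affine[of e ?f 0] e val[of "t / e"] unfolding f by simp
  then have "(\<integral>x. cis (x * t) * complex_of_real (exp (- (e * x)\<^sup>2 / 2)) \<partial>lborel)
      = complex_of_real (sqrt (2 * pi) * exp (- (t / e)\<^sup>2 / 2) / e)"
    using e by (simp add: scaleR_conv_of_real field_simps)
  also have "sqrt (2 * pi) * exp (- (t / e)\<^sup>2 / 2) / e = 2 * pi * normal_density 0 e t"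
  proof -
    have "sqrt (2 * pi) * sqrt (2 * pi) = 2 * pi" by simp
    then show ?thesis
      using e by (simp add: normal_density_def real_sqrt_mult power_divide field_simps)
  qed
  finally show "(\<integral>x. cis (x * t) * complex_of_real (exp (- (e * x)\<^sup>2 / 2)) \<partial>lborel) = complex_of_real (2 * pi * normal_density 0 e t)" .
qed

lemma cis_sum: "finite A \<Longrightarrow> cis (\<Sum>a\<in>A. f a) = (\<Prod>a\<in>A. cis (f a))"
  by (induction A rule: finite_induct) (simp_all add: cis_mult[symmetric])

lemma cis_inner_eq_prod: "cis (x \<bullet> u) = (\<Prod>b\<in>Basis. cis ((x \<bullet> b) * (u \<bullet> b)))"
  for x u :: "'a::euclidean_space"
  by (subst euclidean_inner) (simp add: cis_sum)

lemma
  fixes u :: "'a::euclidean_space"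
  assumes e: "0 < e"
  shows integrable_gauss_fourier: "integrable lborel (\<lambda>x. cis (x \<bullet> u) * complex_of_real (gauss_weight e x))"
    and integral_gauss_fourier: "(\<integral>x. cis (x \<bullet> u) * complex_of_real (gauss_weight e x) \<partial>lborel) =
       complex_of_real ((2 * pi) ^ DIM('a) * gauss_kernel e u)"
proof -
  have eq: "cis (x \<bullet> u) * complex_of_real (gauss_weight e x) =
     (\<Prod>b\<in>Basis. cis ((x \<bullet> b) * (u \<bullet> b)) * complex_of_real (exp (- (e * (x \<bullet> b))\<^sup>2 / 2)))" for x
    unfolding cis_inner_eq_prod gauss_weight_def of_real_prod prod.distrib ..
  show "integrable lborel (\<lambda>x. cis (x \<bullet> u) * complex_of_real (gauss_weight e x))"
    unfolding eq by (rule integrable_lborel_prod) (rule gauss_fourier_1[OF e])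
  show "(\<integral>x. cis (x \<bullet> u) * complex_of_real (gauss_weight e x) \<partial>lborel) =
       complex_of_real ((2 * pi) ^ DIM('a) * gauss_kernel e u)"
    unfolding eq
    by (subst integral_lborel_prod[OF gauss_fourier_1(1)[OF e]])
       (simp_all only: gauss_fourier_1(2)[OF e] of_real_prod[symmetric] prod.distrib[of "\<lambda>_. 2 * pi"] prod_constant gauss_kernel_def)
qed

lemma integrable_gauss_weight: "0 < e \<Longrightarrow> integrable lborel (gauss_weight e :: 'a::euclidean_space \<Rightarrow> real)"
  using integrable_norm[OF integrable_gauss_fourier[of e "0::'a"]] by simp

section \<open>Fourier transforms of integrable functions\<close>

definition fourier :: "('a::euclidean_space \<Rightarrow> complex) \<Rightarrow> 'a \<Rightarrow> complex" where
  "fourier h x = (\<integral>\<xi>. cis (x \<bullet> \<xi>) * h \<xi> \<partial>lborel)"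

lemma borel_measurable_cis [measurable (raw)]:
  "f \<in> borel_measurable M \<Longrightarrow> (\<lambda>x. cis (f x)) \<in> borel_measurable M"
  unfolding cis_conv_exp by measurable

lemma borel_measurable_cnj [measurable (raw)]:
  "f \<in> borel_measurable M \<Longrightarrow> (\<lambda>x. cnj (f x)) \<in> borel_measurable M"
  by (rule measurable_compose[OF _ borel_measurable_continuous_onI]) (auto intro: continuous_intros)

lemma integrable_cis_mult:
  fixes h :: "'a \<Rightarrow> complex"
  assumes "integrable M h" and [measurable]: "f \<in> borel_measurable M"
  shows "integrable M (\<lambda>\<xi>. cis (f \<xi>) * h \<xi>)"
  using assms(1)
  by (rule Bochner_Integration.integrable_bound) (use assms in \<open>auto simp: norm_mult\<close>)

lemma borel_measurable_fourier [measurable]: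
  assumes [measurable]: "h \<in> borel_measurable borel"
  shows "fourier h \<in> borel_measurable borel"
  unfolding fourier_def by measurable

lemma norm_fourier_le:
  assumes "integrable lborel h"
  shows "norm (fourier h x) \<le> (\<integral>\<xi>. norm (h \<xi>) \<partial>lborel)"
  unfolding fourier_def
  by (rule order_trans[OF integral_norm_bound]) (simp add: norm_mult)

text \<open>Transforms of integrable functions are bounded but need not be integrable; the Gaussian
  weight supplies the decay.\<close>

lemma integrable_fourier_mult:
  fixes h k :: "'a::euclidean_space \<Rightarrow> complex"
  assumes h: "integrable lborel h" and k: "integrable lborel k" and e: "0 < e"
  shows "integrable lborel (\<lambda>x. fourier h x * cnj (fourier k x) * complex_of_real (gauss_weight e x))"
proof (rule Bochner_Integration.integrable_bound)
  have [measurable]: "h \<in> borel_measurable borel" "k \<in> borel_measurable borel"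
    using h k by (auto dest: borel_measurable_integrable)
  show "integrable lborel (\<lambda>x::'a. (\<integral>\<xi>. norm (h \<xi>) \<partial>lborel) * (\<integral>\<xi>. norm (k \<xi>) \<partial>lborel) * gauss_weight e x)"
    using integrable_gauss_weight[OF e] by (intro integrable_mult_right)
  show "(\<lambda>x. fourier h x * cnj (fourier k x) * complex_of_real (gauss_weight e x)) \<in> borel_measurable lborel"
    by measurable
  show "AE x in lborel. norm (fourier h x * cnj (fourier k x) * complex_of_real (gauss_weight e x))
    \<le> norm ((\<integral>\<xi>. norm (h \<xi>) \<partial>lborel) * (\<integral>\<xi>. norm (k \<xi>) \<partial>lborel) * gauss_weight e x)"
    by (intro always_eventually allI)
       (auto simp: norm_mult abs_mult intro!: mult_mono norm_fourier_le h k)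
qed

subsection \<open>Plancherel identity\<close>

text \<open>The product of one transform with the conjugate of another is the transform of a
  correlation, and integrating it against the Gaussian weight replaces the oscillation by the
  Gaussian kernel. The sesquilinear form is needed, not only the case \<open>h = k\<close>, because
  the lower bound in \<open>plancherel\<close> pairs \<open>h\<close> with its truncations.\<close>

lemma gauss_polarization:
  fixes h k :: "'a::euclidean_space \<Rightarrow> complex"
  assumes h: "integrable lborel h" and k: "integrable lborel k" and e: "0 < e"
  shows "integrable (lborel \<Otimes>\<^sub>M lborel) (\<lambda>(b, z). cnj (k b) * h (b + z))" (is "integrable _ ?F")
    and "integrable (lborel \<Otimes>\<^sub>M lborel) (\<lambda>(b, z). cnj (k b) * h (b + z) * complex_of_real (gauss_kernel e z))" (is ?I)
    and "(\<integral>x. fourier h x * cnj (fourier k x) * complex_of_real (gauss_weight e x) \<partial>lborel) =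
      complex_of_real ((2 * pi) ^ DIM('a)) *
        (\<integral>(b, z). cnj (k b) * h (b + z) * complex_of_real (gauss_kernel e z) \<partial>(lborel \<Otimes>\<^sub>M lborel))" (is ?E)
proof -
  interpret lborel_triple: pair_sigma_finite "lborel :: 'a measure" "lborel \<Otimes>\<^sub>M lborel :: ('a \<times> 'a) measure"
    unfolding lborel_prod ..
  have [measurable]: "h \<in> borel_measurable borel" "k \<in> borel_measurable borel"
    using h k by (auto dest: borel_measurable_integrable)
  have shift: "(\<integral>z. f (b + z) \<partial>lborel) = (\<integral>z. f z \<partial>lborel)" if "f \<in> borel_measurable borel"
    for f :: "'a \<Rightarrow> 'c::{banach,second_countable_topology}" and b
    using integral_lborel_translate[OF that, of b] by (simp add: add.commute)
  have shifti: "integrable lborel (\<lambda>z. f (b + z))" if "integrable lborel f" for f :: "'a \<Rightarrow> complex" and b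
    using integrable_lborel_translate[OF that, of b] by (simp add: add.commute)
  show F: "integrable (lborel \<Otimes>\<^sub>M lborel) ?F"
  proof (rule lborel_pair.Fubini_integrable)
    have "(\<integral>y. norm (case (x, y) of (b, z) \<Rightarrow> cnj (k b) * h (b + z)) \<partial>lborel) = norm (k x) * (\<integral>y. norm (h y) \<partial>lborel)" for x
      using shift[of "\<lambda>z. norm (h z)" x] by (simp add: norm_mult)
    then show "integrable lborel (\<lambda>x. \<integral>y. norm (case (x, y) of (b, z) \<Rightarrow> cnj (k b) * h (b + z)) \<partial>lborel)"
      using k by simp
    show "AE x in lborel. integrable lborel (\<lambda>y. case (x, y) of (b, z) \<Rightarrow> cnj (k b) * h (b + z))"
      using shifti[OF h] by simp
  qed measurable
  show ?I
  proof (rule Bochner_Integration.integrable_bound)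
    show "integrable (lborel \<Otimes>\<^sub>M lborel) (\<lambda>p. ?F p * complex_of_real (normal_density 0 e 0 ^ DIM('a)))"
      by (intro integrable_mult_left F)
    have "norm (?F p * complex_of_real (gauss_kernel e (snd p))) \<le> norm (?F p * complex_of_real (normal_density 0 e 0 ^ DIM('a)))" for p
      unfolding norm_mult norm_of_real using gauss_kernel_le[of e "snd p"]
      by (intro mult_left_mono) auto
    then show "AE p in lborel \<Otimes>\<^sub>M lborel. norm (case p of (b, z) \<Rightarrow> cnj (k b) * h (b + z) * complex_of_real (gauss_kernel e z))
        \<le> norm (?F p * complex_of_real (normal_density 0 e 0 ^ DIM('a)))"
      by (simp add: case_prod_unfold)
  qed measurable
  let ?w = "\<lambda>x. complex_of_real (gauss_weight e x)"
  \<comment> \<open>Writing the frequency of \<open>h\<close> as \<open>b + z\<close>, where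
    \<open>b\<close> is that of \<open>k\<close>, leaves only the phase
    \<open>x \<bullet> z\<close>.\<close>
  have prod_eq: "fourier h x * cnj (fourier k x) = (\<integral>p. cis (x \<bullet> snd p) * ?F p \<partial>(lborel \<Otimes>\<^sub>M lborel))" for x
  proof -
    have i: "integrable (lborel \<Otimes>\<^sub>M lborel) (\<lambda>p. cis (x \<bullet> snd p) * ?F p)"
      by (rule integrable_cis_mult[OF F]) measurable
    have "(\<integral>p. cis (x \<bullet> snd p) * ?F p \<partial>(lborel \<Otimes>\<^sub>M lborel)) =
        (\<integral>b. \<integral>z. cis (x \<bullet> z) * (cnj (k b) * h (b + z)) \<partial>lborel \<partial>lborel)"
      using lborel_pair.integral_fst'[OF i] by simp
    also have "\<dots> = (\<integral>b. cnj (cis (x \<bullet> b) * k b) * fourier h x \<partial>lborel)"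
    proof (intro Bochner_Integration.integral_cong refl)
      fix b
      have "(\<integral>z. cis (x \<bullet> z) * (cnj (k b) * h (b + z)) \<partial>lborel) =
          (\<integral>z. cnj (cis (x \<bullet> b) * k b) * (cis (x \<bullet> (b + z)) * h (b + z)) \<partial>lborel)"
        by (intro Bochner_Integration.integral_cong refl)
           (simp add: inner_add_right cis_mult[symmetric] cis_cnj cis_neq_zero field_simps cis_inverse[symmetric])
      also have "\<dots> = cnj (cis (x \<bullet> b) * k b) * (\<integral>z. cis (x \<bullet> (b + z)) * h (b + z) \<partial>lborel)"
        by (rule integral_mult_right_zero)
      also have "(\<integral>z. cis (x \<bullet> (b + z)) * h (b + z) \<partial>lborel) = fourier h x"
        using shift[of "\<lambda>z. cis (x \<bullet> z) * h z" b] by (simp add: fourier_def)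
      finally show "(\<integral>z. cis (x \<bullet> z) * (cnj (k b) * h (b + z)) \<partial>lborel) = cnj (cis (x \<bullet> b) * k b) * fourier h x" .
    qed
    also have "\<dots> = (\<integral>b. cnj (cis (x \<bullet> b) * k b) \<partial>lborel) * fourier h x"
      by (rule integral_mult_left_zero)
    also have "(\<integral>b. cnj (cis (x \<bullet> b) * k b) \<partial>lborel) = cnj (fourier k x)"
      unfolding fourier_def by (rule Bochner_Integration.integral_cnj)
    finally show ?thesis by simp
  qed
  \<comment> \<open>The weight makes the integrand absolutely integrable in \<open>x\<close> as
    well, which justifies exchanging \<open>x\<close> with the pair \<open>(b, z)\<close>.\<close>
  let ?G = "\<lambda>x p. cis (x \<bullet> snd p) * ?w x * ?F p"
  have G: "integrable (lborel \<Otimes>\<^sub>M (lborel \<Otimes>\<^sub>M lborel)) (\<lambda>(x, p). ?G x p)"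
  proof (rule lborel_triple.Fubini_integrable)
    have "(\<integral>p. norm (case (x, p) of (x, p) \<Rightarrow> ?G x p) \<partial>(lborel \<Otimes>\<^sub>M lborel)) =
      gauss_weight e x * (\<integral>p. norm (?F p) \<partial>(lborel \<Otimes>\<^sub>M lborel))" for x
      by (simp add: norm_mult)
    then show "integrable lborel (\<lambda>x. \<integral>p. norm (case (x, p) of (x, p) \<Rightarrow> ?G x p) \<partial>(lborel \<Otimes>\<^sub>M lborel))"
      using integrable_gauss_weight[OF e, where 'a = 'a] by simp
    have "integrable (lborel \<Otimes>\<^sub>M lborel) (\<lambda>p. ?w x * (cis (x \<bullet> snd p) * ?F p))" for x
      by (intro integrable_mult_right integrable_cis_mult[OF F]) measurable
    then show "AE x in lborel. integrable (lborel \<Otimes>\<^sub>M lborel) (\<lambda>p. case (x, p) of (x, p) \<Rightarrow> ?G x p)"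
      by (simp add: mult_ac)
  qed measurable
  have "(\<integral>x. fourier h x * cnj (fourier k x) * ?w x \<partial>lborel) = (\<integral>x. \<integral>p. ?G x p \<partial>(lborel \<Otimes>\<^sub>M lborel) \<partial>lborel)"
    unfolding prod_eq
    by (intro Bochner_Integration.integral_cong refl)
       (simp add: integral_mult_right_zero[symmetric] integral_mult_left_zero[symmetric] mult_ac del: integral_mult_right_zero integral_mult_left_zero)
  also have "\<dots> = (\<integral>p. \<integral>x. ?G x p \<partial>lborel \<partial>(lborel \<Otimes>\<^sub>M lborel))"
    by (rule lborel_triple.Fubini_integral[OF G, symmetric])
  also have "\<dots> = (\<integral>p. complex_of_real ((2 * pi) ^ DIM('a)) * (?F p * complex_of_real (gauss_kernel e (snd p))) \<partial>(lborel \<Otimes>\<^sub>M lborel))"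
  proof (intro Bochner_Integration.integral_cong refl)
    fix p :: "'a \<times> 'a"
    have "(\<integral>x. ?G x p \<partial>lborel) = (\<integral>x. cis (x \<bullet> snd p) * ?w x \<partial>lborel) * ?F p"
      by (rule integral_mult_left_zero)
    then show "(\<integral>x. ?G x p \<partial>lborel) = complex_of_real ((2 * pi) ^ DIM('a)) * (?F p * complex_of_real (gauss_kernel e (snd p)))"
      by (simp add: integral_gauss_fourier[OF e])
  qed
  also have "\<dots> = complex_of_real ((2 * pi) ^ DIM('a)) * (\<integral>p. ?F p * complex_of_real (gauss_kernel e (snd p)) \<partial>(lborel \<Otimes>\<^sub>M lborel))"
    by (rule integral_mult_right_zero)
  finally show ?E
    by (simp add: case_prod_unfold)
qed

text \<open>Since the kernel has mass 1, the error is an average of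
  \<open>cnj (k b) * (h (b + z) - h b)\<close>. Boundedness of \<open>k\<close> reduces it to
  \<open>M\<close> times the Gaussian mean of the L^1 modulus of continuity of \<open>h\<close>.
  After rescaling, the parameter sits only in the shift, and dominated convergence applies with
  twice the L^1 norm of \<open>h\<close> in the majorant.\<close>

lemma gauss_approx_identity:
  fixes h k :: "'a::euclidean_space \<Rightarrow> complex"
  assumes h: "integrable lborel h" and k: "integrable lborel k" and M: "\<And>x. norm (k x) \<le> M"
  shows "(\<lambda>n. \<integral>(b, z). cnj (k b) * h (b + z) * complex_of_real (gauss_kernel (inverse (Suc n)) z) \<partial>(lborel \<Otimes>\<^sub>M lborel))
    \<longlonglongrightarrow> (\<integral>b. cnj (k b) * h b \<partial>lborel)"
proof -
  have [measurable]: "h \<in> borel_measurable borel" "k \<in> borel_measurable borel"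
    using h k by (auto dest: borel_measurable_integrable)
  have M0: "0 \<le> M" using M[of 0] norm_ge_zero by (rule order_trans[rotated])
  have hk: "integrable lborel (\<lambda>b. cnj (k b) * h b)"
  proof (rule Bochner_Integration.integrable_bound)
    show "integrable lborel (\<lambda>b. M * norm (h b))" using h by simp
    show "AE b in lborel. norm (cnj (k b) * h b) \<le> norm (M * norm (h b))"
      using M M0 by (auto simp: norm_mult abs_mult intro!: mult_right_mono)
  qed measurable
  let ?\<tau> = "L1_translation h"
  have \<tau>_meas [measurable]: "?\<tau> \<in> borel_measurable borel"
    unfolding L1_translation_def[abs_def] by measurable
  let ?C = "2 * (\<integral>x. norm (h x) \<partial>lborel)"
  have bound: "norm ((\<integral>(b, z). cnj (k b) * h (b + z) * complex_of_real (gauss_kernel e z) \<partial>(lborel \<Otimes>\<^sub>M lborel))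
      - (\<integral>b. cnj (k b) * h b \<partial>lborel)) \<le> M * (\<integral>z. gauss_kernel 1 z * ?\<tau> (e *\<^sub>R z) \<partial>lborel)" if e: "0 < e" for e
  proof -
    let ?K = "\<lambda>z::'a. complex_of_real (gauss_kernel e z)"
    let ?A = "\<lambda>p. case p of (b, z) \<Rightarrow> cnj (k b) * h (b + z) * ?K z"
    let ?B = "\<lambda>p. case p of (b, z) \<Rightarrow> cnj (k b) * h b * ?K z"
    let ?D = "\<lambda>b z. cnj (k b) * (h (b + z) - h b) * ?K z"
    have A: "integrable (lborel \<Otimes>\<^sub>M lborel) ?A"
      by (rule gauss_polarization(2)[OF h k e])
    have B: "integrable (lborel \<Otimes>\<^sub>M lborel) ?B"
    proof (rule lborel_pair.Fubini_integrable)
      have "(\<integral>y. norm (?B (x, y)) \<partial>lborel) = norm (cnj (k x) * h x)" for x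
        using integral_gauss_kernel[OF e, where 'a = 'a] by (simp add: norm_mult)
      then show "integrable lborel (\<lambda>x. \<integral>y. norm (?B (x, y)) \<partial>lborel)"
        using hk by simp
      show "AE x in lborel. integrable lborel (\<lambda>y. ?B (x, y))"
        using integrable_gauss_kernel[OF e, where 'a = 'a] by (simp add: integrable_of_real)
    qed measurable
    have Bv: "(\<integral>p. ?B p \<partial>(lborel \<Otimes>\<^sub>M lborel)) = (\<integral>b. cnj (k b) * h b \<partial>lborel)"
    proof -
      have "(\<integral>z. ?K z \<partial>lborel) = 1"
        using integral_gauss_kernel[OF e, where 'a = 'a] by (simp add: integral_of_real)
      then show ?thesis
        using lborel_pair.integral_fst'[OF B] by simp
    qed
    have D: "integrable (lborel \<Otimes>\<^sub>M lborel) (\<lambda>(b, z). ?D b z)"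
      using Bochner_Integration.integrable_diff[OF A B] by (simp add: case_prod_unfold algebra_simps)
    have nD: "integrable (lborel \<Otimes>\<^sub>M lborel) (\<lambda>(b, z). norm (?D b z))"
      using integrable_norm[OF D] by (simp add: case_prod_unfold)
    have "norm ((\<integral>p. ?A p \<partial>(lborel \<Otimes>\<^sub>M lborel)) - (\<integral>b. cnj (k b) * h b \<partial>lborel))
        = norm (\<integral>(b, z). ?D b z \<partial>(lborel \<Otimes>\<^sub>M lborel))"
      unfolding Bv[symmetric] Bochner_Integration.integral_diff[OF A B, symmetric]
      by (simp add: case_prod_unfold algebra_simps)
    also have "\<dots> \<le> (\<integral>(b, z). norm (?D b z) \<partial>(lborel \<Otimes>\<^sub>M lborel))"
      using integral_norm_bound[of "lborel \<Otimes>\<^sub>M lborel" "\<lambda>(b, z). ?D b z"] by (simp add: case_prod_unfold)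
    also have "\<dots> = (\<integral>z. \<integral>b. norm (?D b z) \<partial>lborel \<partial>lborel)"
      by (rule lborel_pair.integral_snd[OF nD, symmetric])
    also have "\<dots> \<le> (\<integral>z. M * (gauss_kernel e z * ?\<tau> z) \<partial>lborel)"
    proof (rule integral_mono)
      show "integrable lborel (\<lambda>z. \<integral>b. norm (?D b z) \<partial>lborel)"
        by (rule lborel_pair.integrable_snd[OF nD])
      show "integrable lborel (\<lambda>z. M * (gauss_kernel e z * ?\<tau> z))"
      proof (rule integrable_mult_right, rule Bochner_Integration.integrable_bound)
        show "integrable lborel (\<lambda>z::'a. gauss_kernel e z * ?C)"
          by (intro integrable_mult_left integrable_gauss_kernel e)
        show "AE z in lborel. norm (gauss_kernel e z * ?\<tau> z) \<le> norm (gauss_kernel e z * ?C)"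
          using L1_translation_bound[OF h] by (auto simp: abs_mult intro!: mult_left_mono)
      qed measurable
      fix z
      have "(\<integral>b. norm (?D b z) \<partial>lborel) \<le> (\<integral>b. M * gauss_kernel e z * norm (h (b + z) - h b) \<partial>lborel)"
      proof (rule integral_mono')
        show "integrable lborel (\<lambda>b. M * gauss_kernel e z * norm (h (b + z) - h b))"
          using h integrable_lborel_translate[OF h, of z] by (intro integrable_mult_right integrable_norm) auto
        show "norm (?D b z) \<le> M * gauss_kernel e z * norm (h (b + z) - h b)" for b
          using mult_right_mono[OF M[of b], of "gauss_kernel e z * norm (h (b + z) - h b)"]
          by (simp add: norm_mult mult_ac)
        show "0 \<le> M * gauss_kernel e z * norm (h (b + z) - h b)" for b using M0 by simp
      qed
      also have "\<dots> = M * (gauss_kernel e z * ?\<tau> z)"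
        by (simp add: L1_translation_def)
      finally show "(\<integral>b. norm (?D b z) \<partial>lborel) \<le> M * (gauss_kernel e z * ?\<tau> z)" .
    qed
    also have "\<dots> = M * (\<integral>z. gauss_kernel e z * ?\<tau> z \<partial>lborel)"
      by simp
    also have "(\<integral>z. gauss_kernel e z * ?\<tau> z \<partial>lborel) = (\<integral>z. gauss_kernel 1 z * ?\<tau> (e *\<^sub>R z) \<partial>lborel)"
      by (subst integral_lborel_scale[OF _ e])
         (simp_all add: gauss_kernel_scale[OF e, symmetric] mult.assoc)
    finally show ?thesis .
  qed
  let ?e = "\<lambda>n. inverse (real (Suc n))"
  have "(\<lambda>n. \<integral>z. gauss_kernel 1 z * ?\<tau> (?e n *\<^sub>R z) \<partial>lborel) \<longlonglongrightarrow> (\<integral>z. (0::real) \<partial>(lborel :: 'a measure))"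
  proof (rule integral_dominated_convergence[where w = "\<lambda>z. gauss_kernel 1 z * ?C"])
    show "integrable lborel (\<lambda>z::'a. gauss_kernel 1 z * ?C)"
      using integrable_gauss_kernel[of 1, where 'a = 'a] by simp
    show "AE z in lborel. norm (gauss_kernel 1 z * ?\<tau> (?e n *\<^sub>R z)) \<le> gauss_kernel 1 z * ?C" for n
      using L1_translation_bound[OF h] by (auto simp: abs_mult intro!: mult_left_mono)
    show "AE z in lborel. (\<lambda>n. gauss_kernel 1 z * ?\<tau> (?e n *\<^sub>R z)) \<longlonglongrightarrow> 0"
    proof (intro always_eventually allI tendsto_mult_right_zero tendsto_L1_translation h)
      fix z :: 'a
      show "(\<lambda>n. ?e n *\<^sub>R z) \<longlonglongrightarrow> 0"
        using tendsto_scaleR[OF LIMSEQ_inverse_real_of_nat tendsto_const, of z] by simp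
    qed
  qed measurable
  from tendsto_mult_right_zero[OF this[simplified], of M]
  have lim: "(\<lambda>n. M * (\<integral>z. gauss_kernel 1 z * ?\<tau> (?e n *\<^sub>R z) \<partial>lborel)) \<longlonglongrightarrow> 0"
    by simp
  show ?thesis
    by (rule LIM_zero_cancel, rule Lim_null_comparison[OF _ lim])
       (intro always_eventually allI bound, simp)
qed

text \<open>Two inequalities, because neither side is assumed finite. The upper bound follows from
  the arithmetic-geometric mean inequality for the Gaussian form and Fatou. The lower bound compares
  \<open>h\<close> with bounded truncations, for which the Gaussian limit is available. The constant
  reflects the unnormalised \<open>fourier\<close>.\<close>

theorem plancherel:
  fixes h :: "'a::euclidean_space \<Rightarrow> complex"
  assumes h: "integrable lborel h"
  shows "(\<integral>\<^sup>+x. ennreal ((cmod (fourier h x))\<^sup>2) \<partial>lborel) =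
    ennreal ((2 * pi) ^ DIM('a)) * (\<integral>\<^sup>+\<xi>. ennreal ((cmod (h \<xi>))\<^sup>2) \<partial>lborel)"
proof (rule antisym)
  have [measurable]: "h \<in> borel_measurable borel"
    using h by (auto dest: borel_measurable_integrable)
  let ?c = "(2 * pi) ^ DIM('a)"
  let ?e = "\<lambda>n. inverse (real (Suc n))"
  have e: "0 < ?e n" for n by simp
  let ?L = "\<integral>\<^sup>+x. ennreal ((cmod (fourier h x))\<^sup>2) \<partial>lborel"
  let ?R = "\<integral>\<^sup>+\<xi>. ennreal ((cmod (h \<xi>))\<^sup>2) \<partial>lborel"
  define A where "A = (\<lambda>n h k. \<integral>x. fourier h x * cnj (fourier k x) * complex_of_real (gauss_weight (?e n) x) \<partial>(lborel::'a measure))"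
  have A_self: "(\<integral>\<^sup>+x. ennreal ((cmod (fourier h x))\<^sup>2 * gauss_weight (?e n) x) \<partial>lborel) = ennreal (Re (A n h h))"
    if h: "integrable lborel h" for n and h :: "'a \<Rightarrow> complex"
  proof -
    note i = integrable_fourier_mult[OF h h e, of n]
    have eq: "Re (fourier h x * cnj (fourier h x) * complex_of_real (gauss_weight (?e n) x)) = (cmod (fourier h x))\<^sup>2 * gauss_weight (?e n) x" for x
      by (simp add: complex_norm_square[symmetric] del: of_real_power of_real_mult flip: of_real_mult of_real_power)
    show ?thesis
      using integrable_Re[OF i] integral_Re[OF i] unfolding A_def eq
      by (subst nn_integral_eq_integral) auto
  qed
  have w_lim: "(\<lambda>n. gauss_weight (?e n) x) \<longlonglongrightarrow> 1" for x :: 'a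
  proof -
    have "(\<lambda>n. gauss_weight (?e n) x) \<longlonglongrightarrow> (\<Prod>b\<in>(Basis::'a set). exp (- (0 * (x \<bullet> b))\<^sup>2 / 2))"
      unfolding gauss_weight_def by (intro tendsto_intros LIMSEQ_inverse_real_of_nat) auto
    then show ?thesis by simp
  qed
  show "?L \<le> ennreal ?c * ?R"
  proof -
    have upper: "(\<integral>\<^sup>+x. ennreal ((cmod (fourier h x))\<^sup>2 * gauss_weight (?e n) x) \<partial>lborel) \<le> ennreal ?c * ?R" for n
    proof -
      let ?k = "gauss_kernel (?e n) :: 'a \<Rightarrow> real"
      let ?F = "\<lambda>p. case p of (b, z) \<Rightarrow> cnj (h b) * h (b + z) * complex_of_real (?k z)"
      have "ennreal (Re (A n h h)) \<le> ennreal (cmod (A n h h))"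
        by (intro ennreal_leI complex_Re_le_cmod)
      also have "\<dots> = ennreal ?c * ennreal (norm (\<integral>p. ?F p \<partial>(lborel \<Otimes>\<^sub>M lborel)))"
        unfolding A_def gauss_polarization(3)[OF h h e]
        by (simp add: norm_mult ennreal_mult norm_power)
      also have "ennreal (norm (\<integral>p. ?F p \<partial>(lborel \<Otimes>\<^sub>M lborel))) \<le> (\<integral>\<^sup>+p. ennreal (norm (?F p)) \<partial>(lborel \<Otimes>\<^sub>M lborel))"
        by (rule integral_norm_bound_ennreal) (rule gauss_polarization(2)[OF h h e])
      \<comment> \<open>Each half integrates to half of \<open>?R\<close>: the first directly, the
        second by translation invariance in \<open>b\<close>, since the kernel has mass 1.\<close>
      also have "\<dots> \<le> (\<integral>\<^sup>+p. ennreal (1/2) * (ennreal ((cmod (h (fst p)))\<^sup>2) * ennreal (?k (snd p)))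
           + ennreal (1/2) * (ennreal ((cmod (h (fst p + snd p)))\<^sup>2) * ennreal (?k (snd p))) \<partial>(lborel \<Otimes>\<^sub>M lborel))"
      proof (rule nn_integral_mono)
        fix p :: "'a \<times> 'a"
        have *: "norm (?F p) \<le> 1/2 * ((cmod (h (fst p)))\<^sup>2 * ?k (snd p)) + 1/2 * ((cmod (h (fst p + snd p)))\<^sup>2 * ?k (snd p))"
        proof -
          have "cmod (h (fst p)) * cmod (h (fst p + snd p)) \<le> 1/2 * (cmod (h (fst p)))\<^sup>2 + 1/2 * (cmod (h (fst p + snd p)))\<^sup>2"
            using sum_squares_bound[of "cmod (h (fst p))" "cmod (h (fst p + snd p))"] by simp
          from mult_right_mono[OF this, of "?k (snd p)"] show ?thesis
            by (simp add: case_prod_unfold norm_mult algebra_simps)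
        qed
        show "ennreal (norm (?F p)) \<le> ennreal (1/2) * (ennreal ((cmod (h (fst p)))\<^sup>2) * ennreal (?k (snd p)))
           + ennreal (1/2) * (ennreal ((cmod (h (fst p + snd p)))\<^sup>2) * ennreal (?k (snd p)))"
          using ennreal_leI[OF *] by (simp only: ennreal_mult ennreal_plus mult_nonneg_nonneg zero_le_power2 gauss_nonneg divide_nonneg_nonneg zero_le_one zero_le_numeral)
      qed
      also have "\<dots> = ennreal (1/2) * (\<integral>\<^sup>+p. ennreal ((cmod (h (fst p)))\<^sup>2) * ennreal (?k (snd p)) \<partial>(lborel \<Otimes>\<^sub>M lborel))
          + ennreal (1/2) * (\<integral>\<^sup>+p. ennreal ((cmod (h (fst p + snd p)))\<^sup>2) * ennreal (?k (snd p)) \<partial>(lborel \<Otimes>\<^sub>M lborel))"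
        by (simp add: nn_integral_add nn_integral_cmult)
      also have "(\<integral>\<^sup>+p. ennreal ((cmod (h (fst p)))\<^sup>2) * ennreal (?k (snd p)) \<partial>(lborel \<Otimes>\<^sub>M lborel)) = ?R"
        by (subst lborel.nn_integral_fst[symmetric])
           (simp_all add: nn_integral_cmult nn_integral_gauss_kernel[OF e] del: of_nat_Suc)
      also have "(\<integral>\<^sup>+p. ennreal ((cmod (h (fst p + snd p)))\<^sup>2) * ennreal (?k (snd p)) \<partial>(lborel \<Otimes>\<^sub>M lborel)) = ?R"
      proof -
        have "(\<integral>\<^sup>+p. ennreal ((cmod (h (fst p + snd p)))\<^sup>2) * ennreal (?k (snd p)) \<partial>(lborel \<Otimes>\<^sub>M lborel)) =
           (\<integral>\<^sup>+z. \<integral>\<^sup>+b. ennreal ((cmod (h (b + z)))\<^sup>2) * ennreal (?k z) \<partial>lborel \<partial>lborel)"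
          by (subst lborel_pair.nn_integral_snd[symmetric]) (simp_all add: case_prod_unfold)
        also have "\<dots> = (\<integral>\<^sup>+z. ?R * ennreal (?k z) \<partial>lborel)"
          using nn_integral_lborel_translate[of "\<lambda>b. ennreal ((cmod (h b))\<^sup>2)"]
          by (simp add: nn_integral_multc)
        also have "\<dots> = ?R"
          by (simp add: nn_integral_cmult nn_integral_gauss_kernel[OF e] del: of_nat_Suc)
        finally show ?thesis .
      qed
      also have "ennreal (1/2) * ?R + ennreal (1/2) * ?R = ?R"
      proof -
        have "ennreal (1/2) + ennreal (1/2) = 1"
          by (subst ennreal_plus[symmetric]) (simp_all del: ennreal_plus)
        then show ?thesis
          by (simp only: distrib_right[symmetric] mult_1_left)
      qed
      finally show ?thesis
        unfolding A_self[OF h] by (simp add: mult_left_mono)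
    qed
    \<comment> \<open>The weights tend to 1 pointwise, so Fatou removes them from the uniform bound
      \<open>upper\<close>.\<close>
    have "?L = (\<integral>\<^sup>+x. liminf (\<lambda>n. ennreal ((cmod (fourier h x))\<^sup>2 * gauss_weight (?e n) x)) \<partial>lborel)"
    proof (intro nn_integral_cong)
      fix x
      have "(\<lambda>n. ennreal ((cmod (fourier h x))\<^sup>2 * gauss_weight (?e n) x)) \<longlonglongrightarrow> ennreal ((cmod (fourier h x))\<^sup>2 * 1)"
        by (intro tendsto_intros w_lim)
      from lim_imp_Liminf[OF _ this]
      show "ennreal ((cmod (fourier h x))\<^sup>2) = liminf (\<lambda>n. ennreal ((cmod (fourier h x))\<^sup>2 * gauss_weight (?e n) x))"
        by (simp del: of_nat_Suc)
    qed
    also have "\<dots> \<le> liminf (\<lambda>n. \<integral>\<^sup>+x. ennreal ((cmod (fourier h x))\<^sup>2 * gauss_weight (?e n) x) \<partial>lborel)"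
      by (rule nn_integral_liminf) measurable
    also have "\<dots> \<le> liminf (\<lambda>n::nat. ennreal ?c * ?R)"
      by (intro Liminf_mono always_eventually allI upper)
    finally show ?thesis
      by (simp add: Liminf_const)
  qed
  show "ennreal ?c * ?R \<le> ?L"
  proof (cases "?L = \<infinity>")
    case False
    then obtain r where r: "0 \<le> r" "?L = ennreal r"
      by (cases ?L) auto
    \<comment> \<open>The truncation is bounded and dominated by \<open>h\<close>, hence integrable
      and square integrable. Where it is nonzero it equals \<open>h\<close>, so its pairings with
      \<open>h\<close> and with itself have the same limit.\<close>
    define \<psi> where "\<psi> = (\<lambda>(m::nat) x. if cmod (h x) \<le> real m then h x else 0)"
    have lower: "ennreal ?c * (\<integral>\<^sup>+x. ennreal ((cmod (\<psi> m x))\<^sup>2) \<partial>lborel) \<le> ?L" for m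
    proof -
      have [measurable]: "\<psi> m \<in> borel_measurable borel"
        unfolding \<psi>_def by measurable
      have \<psi>: "integrable lborel (\<psi> m)"
        by (rule Bochner_Integration.integrable_bound[OF h]) (auto simp: \<psi>_def)
      have \<psi>_bound: "cmod (\<psi> m x) \<le> real m" for x
        by (simp add: \<psi>_def)
      have \<psi>h: "cnj (\<psi> m x) * h x = complex_of_real ((cmod (\<psi> m x))\<^sup>2)" for x
        unfolding complex_norm_square by (simp add: \<psi>_def)
      have \<psi>\<psi>: "cnj (\<psi> m x) * \<psi> m x = complex_of_real ((cmod (\<psi> m x))\<^sup>2)" for x
        unfolding complex_norm_square by (rule mult.commute)
      let ?s = "\<integral>x. (cmod (\<psi> m x))\<^sup>2 \<partial>lborel"
      have i2: "integrable lborel (\<lambda>x. (cmod (\<psi> m x))\<^sup>2)"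
      proof (rule Bochner_Integration.integrable_bound)
        show "integrable lborel (\<lambda>x. real m * cmod (h x))" using h by simp
        show "AE x in lborel. norm ((cmod (\<psi> m x))\<^sup>2) \<le> norm (real m * cmod (h x))"
          by (auto simp: \<psi>_def power2_eq_square intro!: mult_right_mono)
      qed measurable
      have lim1: "(\<lambda>n. A n h (\<psi> m)) \<longlonglongrightarrow> complex_of_real ?c * complex_of_real ?s"
        unfolding A_def gauss_polarization(3)[OF h \<psi> e]
        using gauss_approx_identity[OF h \<psi> \<psi>_bound] unfolding \<psi>h integral_complex_of_real
        by (intro tendsto_intros)
      have lim2: "(\<lambda>n. A n (\<psi> m) (\<psi> m)) \<longlonglongrightarrow> complex_of_real ?c * complex_of_real ?s"
        unfolding A_def gauss_polarization(3)[OF \<psi> \<psi> e]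
        using gauss_approx_identity[OF \<psi> \<psi> \<psi>_bound] unfolding \<psi>\<psi> integral_complex_of_real
        by (intro tendsto_intros)
      have "(\<lambda>n. 2 * Re (A n h (\<psi> m)) - Re (A n (\<psi> m) (\<psi> m))) \<longlonglongrightarrow>
          2 * Re (complex_of_real ?c * complex_of_real ?s) - Re (complex_of_real ?c * complex_of_real ?s)"
        by (intro tendsto_intros lim1 lim2)
      then have lim: "(\<lambda>n. 2 * Re (A n h (\<psi> m)) - Re (A n (\<psi> m) (\<psi> m))) \<longlonglongrightarrow> ?c * ?s"
        by (simp only: of_real_mult[symmetric] Re_complex_of_real mult_2[of "?c * ?s"] add_diff_cancel_right')
      have "2 * Re (A n h (\<psi> m)) - Re (A n (\<psi> m) (\<psi> m)) \<le> r" for n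
      proof -
        let ?w = "\<lambda>x. complex_of_real (gauss_weight (?e n) x)"
        note ii = integrable_fourier_mult[OF h h e, of n] integrable_fourier_mult[OF h \<psi> e, of n]
          integrable_fourier_mult[OF \<psi> \<psi> e, of n]
        \<comment> \<open>This is the expanded squared distance between the transforms of
          \<open>h\<close> and \<open>\<psi> m\<close>. Its positivity bounds twice the mixed term
          minus the truncated term by the full term; in the limit the left side is
          \<open>2 * (?c * ?s) - ?c * ?s\<close>.\<close>
        have pos: "0 \<le> Re (fourier h x * cnj (fourier h x) * ?w x) - 2 * Re (fourier h x * cnj (fourier (\<psi> m) x) * ?w x)
           + Re (fourier (\<psi> m) x * cnj (fourier (\<psi> m) x) * ?w x)" (is "0 \<le> ?P x") for x
        proof -
          have "?P x = (cmod (fourier h x - fourier (\<psi> m) x))\<^sup>2 * gauss_weight (?e n) x"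
            unfolding cmod_power2 by (simp add: power2_eq_square algebra_simps)
          then show ?thesis by simp
        qed
        have "0 \<le> (\<integral>x. ?P x \<partial>lborel)"
          by (rule integral_nonneg_AE) (use pos in auto)
        also have "\<dots> = Re (A n h h) - 2 * Re (A n h (\<psi> m)) + Re (A n (\<psi> m) (\<psi> m))"
          unfolding A_def using ii[THEN integrable_Re] ii[THEN integral_Re] by simp
        finally have 1: "2 * Re (A n h (\<psi> m)) - Re (A n (\<psi> m) (\<psi> m)) \<le> Re (A n h h)" by simp
        have "ennreal (Re (A n h h)) \<le> ?L"
          unfolding A_self[OF h, symmetric]
          by (intro nn_integral_mono ennreal_leI) (simp add: mult_left_le gauss_weight_le_1)
        then have "Re (A n h h) \<le> r"
          using r by simp
        with 1 show ?thesis by simp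
      qed
      then have "?c * ?s \<le> r"
        by (intro LIMSEQ_le_const2[OF lim]) auto
      then have "ennreal ?c * ennreal ?s \<le> ennreal r"
        by (simp add: ennreal_mult'[symmetric] ennreal_leI)
      then show ?thesis
        using r by (simp add: nn_integral_eq_integral[OF i2])
    qed
    have [measurable]: "\<psi> m \<in> borel_measurable borel" for m
      unfolding \<psi>_def by measurable
    have "ennreal ?c * ?R = (\<integral>\<^sup>+x. ennreal ?c * ennreal ((cmod (h x))\<^sup>2) \<partial>lborel)"
      by (subst nn_integral_cmult) auto
    \<comment> \<open>At each point the truncations are eventually equal to \<open>h\<close>, so
      Fatou passes from them to \<open>h\<close>.\<close>
    also have "\<dots> = (\<integral>\<^sup>+x. liminf (\<lambda>m. ennreal ?c * ennreal ((cmod (\<psi> m x))\<^sup>2)) \<partial>lborel)"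
    proof (intro nn_integral_cong)
      fix x
      obtain N where N: "cmod (h x) \<le> real N"
        using real_arch_simple by blast
      have "\<forall>\<^sub>F m in sequentially. ennreal ?c * ennreal ((cmod (\<psi> m x))\<^sup>2) = ennreal ?c * ennreal ((cmod (h x))\<^sup>2)"
        unfolding eventually_sequentially
        by (intro exI[of _ N]) (use N in \<open>auto simp: \<psi>_def\<close>)
      from lim_imp_Liminf[OF _ tendsto_eventually[OF this]]
      show "ennreal ?c * ennreal ((cmod (h x))\<^sup>2) = liminf (\<lambda>m. ennreal ?c * ennreal ((cmod (\<psi> m x))\<^sup>2))"
        by simp
    qed
    also have "\<dots> \<le> liminf (\<lambda>m. \<integral>\<^sup>+x. ennreal ?c * ennreal ((cmod (\<psi> m x))\<^sup>2) \<partial>lborel)"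
      by (rule nn_integral_liminf) measurable
    also have "\<dots> = liminf (\<lambda>m. ennreal ?c * (\<integral>\<^sup>+x. ennreal ((cmod (\<psi> m x))\<^sup>2) \<partial>lborel))"
      by (subst nn_integral_cmult) auto
    also have "\<dots> \<le> liminf (\<lambda>m::nat. ?L)"
      by (intro Liminf_mono always_eventually allI lower)
    finally show ?thesis
      by (simp add: Liminf_const)
  qed simp
qed

subsection \<open>Product measures\<close>

lemma borel_measurable_vec_lambda [measurable (raw)]:
  fixes f :: "'i::finite \<Rightarrow> 'c \<Rightarrow> 'b::euclidean_space"
  assumes [measurable]: "\<And>i. f i \<in> borel_measurable M"
  shows "(\<lambda>x. \<chi> i. f i x) \<in> borel_measurable M"
  by (rule borel_measurable_euclidean_space[THEN iffD2]) (auto simp: Basis_vec_def inner_axis)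

lemma borel_measurable_vec_nth [measurable (raw)]:
  fixes f :: "'c \<Rightarrow> 'b::euclidean_space ^ 'i::finite"
  shows "f \<in> borel_measurable M \<Longrightarrow> (\<lambda>x. f x $ i) \<in> borel_measurable M"
  by (rule measurable_compose[OF _ borel_measurable_continuous_onI]) (auto intro: continuous_intros)

lemma
  fixes f :: "'c \<Rightarrow> 'a::euclidean_space \<times> 'b::euclidean_space"
  assumes f: "f \<in> borel_measurable M"
  shows borel_measurable_fst_borel [measurable (raw)]: "(\<lambda>x. fst (f x)) \<in> borel_measurable M"
    and borel_measurable_snd_borel [measurable (raw)]: "(\<lambda>x. snd (f x)) \<in> borel_measurable M"
  using f by (rule measurable_compose[OF _ borel_measurable_continuous_onI], intro continuous_intros)+

lemma prod_Basis_vec: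
  fixes f :: "'b::euclidean_space ^ 'i::finite \<Rightarrow> 'c::comm_monoid_mult"
  shows "(\<Prod>b\<in>Basis. f b) = (\<Prod>i\<in>UNIV. \<Prod>b\<in>Basis. f (axis i b))"
proof -
  have B: "(Basis :: ('b ^ 'i) set) = (\<lambda>(i, b). axis i b) ` (UNIV \<times> Basis)"
    by (auto simp: Basis_vec_def)
  have inj: "inj_on (\<lambda>(i, b). axis i b :: 'b ^ 'i) (UNIV \<times> Basis)"
    by (auto simp: inj_on_def axis_eq_axis)
  show ?thesis
    unfolding B by (subst prod.reindex[OF inj]) (simp add: prod.cartesian_product case_prod_unfold)
qed

lemma mem_box_vec:
  fixes x :: "'b::euclidean_space ^ 'i::finite"
  shows "x \<in> box l u \<longleftrightarrow> (\<forall>i. x $ i \<in> box (l $ i) (u $ i))"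
  by (auto simp: mem_box Basis_vec_def inner_axis)

lemma mem_box_prod:
  fixes x :: "'b::euclidean_space \<times> 'c::euclidean_space"
  shows "x \<in> box l u \<longleftrightarrow> fst x \<in> box (fst l) (fst u) \<and> snd x \<in> box (snd l) (snd u)"
  by (auto simp: mem_box Basis_prod_def inner_prod_def ball_Un)

lemma emeasure_lborel_Times:
  fixes A :: "'b::euclidean_space set" and B :: "'c::euclidean_space set"
  assumes [measurable]: "A \<in> sets borel" "B \<in> sets borel"
  shows "emeasure lborel (A \<times> B) = emeasure lborel A * emeasure lborel B"
  unfolding lborel_prod[symmetric] by (rule lborel.emeasure_pair_measure_Times) auto

lemma lborel_eq_boxI:
  fixes M :: "'a::euclidean_space measure"
  assumes "sets M = sets borel" and "\<And>l u. emeasure M (box l u) = emeasure lborel (box l u)"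
  shows "M = lborel"
  using assms by (intro lborel_eqI[symmetric]) auto

interpretation lborel_product: product_sigma_finite "\<lambda>_::'i. lborel :: 'b::euclidean_space measure" ..

lemma distr_vec_lambda_lborel:
  "distr (\<Pi>\<^sub>M i\<in>(UNIV :: 'i::finite set). lborel :: 'b::euclidean_space measure) borel vec_lambda = lborel"
proof (rule lborel_eqI[symmetric])
  fix l u :: "'b ^ 'i"
  assume le: "\<And>b. b \<in> Basis \<Longrightarrow> l \<bullet> b \<le> u \<bullet> b"
  let ?P = "\<Pi>\<^sub>M i\<in>(UNIV :: 'i set). lborel :: 'b measure"
  have m: "vec_lambda \<in> measurable ?P borel"
    by measurable
  have le': "l $ i \<bullet> b \<le> u $ i \<bullet> b" if "b \<in> Basis" for i b
    using le[of "axis i b"] that by (auto simp: Basis_vec_def inner_axis)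
  have "vec_lambda -` box l u \<inter> space ?P = PiE UNIV (\<lambda>i. box (l $ i) (u $ i))"
    by (auto simp: mem_box_vec space_PiM PiE_iff)
  then have "emeasure (distr ?P borel vec_lambda) (box l u) = (\<Prod>i\<in>UNIV. emeasure lborel (box (l $ i) (u $ i)))"
    by (simp add: emeasure_distr[OF m] lborel_product.emeasure_PiM)
  also have "\<dots> = ennreal (\<Prod>b\<in>Basis. (u - l) \<bullet> b)"
    by (simp add: emeasure_lborel_box le' prod_Basis_vec inner_axis prod_ennreal prod_nonneg inner_diff_left)
  finally show "emeasure (distr ?P borel vec_lambda) (box l u) = ennreal (\<Prod>b\<in>Basis. (u - l) \<bullet> b)" .
qed simp

lemma emeasure_lborel_vec:
  fixes A :: "'i::finite \<Rightarrow> 'b::euclidean_space set"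
  assumes [measurable]: "\<And>i. A i \<in> sets borel"
  shows "emeasure lborel {x. \<forall>i. x $ i \<in> A i} = (\<Prod>i\<in>UNIV. emeasure lborel (A i))"
proof -
  let ?P = "\<Pi>\<^sub>M i\<in>(UNIV :: 'i set). lborel :: 'b measure"
  have [measurable]: "{x :: 'b ^ 'i. \<forall>i. x $ i \<in> A i} \<in> sets borel"
    by measurable
  have "vec_lambda -` {x. \<forall>i. x $ i \<in> A i} \<inter> space ?P = PiE UNIV A"
    by (auto simp: space_PiM PiE_iff)
  then show ?thesis
    by (subst distr_vec_lambda_lborel[symmetric])
       (simp add: emeasure_distr lborel_product.emeasure_PiM)
qed

lemma emeasure_box_vec:
  fixes l u :: "'b::euclidean_space ^ 'i::finite"
  shows "emeasure lborel (box l u) = (\<Prod>i\<in>UNIV. emeasure lborel (box (l $ i) (u $ i)))"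
proof -
  have "box l u = {x. \<forall>i. x $ i \<in> box (l $ i) (u $ i)}"
    by (auto simp: mem_box_vec)
  then show ?thesis by (simp add: emeasure_lborel_vec)
qed

text \<open>Regroups the points of the convolution into the tuple of spatial parts and the vector of
  last coordinates, so that Plancherel can be applied in each group separately.\<close>

lemma distr_PiM_pair_lborel:
  "distr (\<Pi>\<^sub>M i\<in>(UNIV :: 'i::finite set). lborel :: ('b::euclidean_space \<times> 'c::euclidean_space) measure) borel
     (\<lambda>x. (\<chi> i. fst (x i), \<chi> i. snd (x i))) = lborel" (is "distr ?P borel ?f = lborel")
proof (rule lborel_eq_boxI)
  fix l u :: "('b ^ 'i) \<times> ('c ^ 'i)"
  have m: "?f \<in> measurable ?P borel"
    by measurable
  let ?B = "\<lambda>i. box (fst l $ i) (fst u $ i) \<times> box (snd l $ i) (snd u $ i)"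
  have "?f -` box l u \<inter> space ?P = PiE UNIV ?B"
    by (auto simp: mem_box_vec mem_box_prod space_PiM PiE_iff mem_Times_iff)
  then have "emeasure (distr ?P borel ?f) (box l u) = (\<Prod>i\<in>UNIV. emeasure lborel (?B i))"
    by (simp add: emeasure_distr[OF m] lborel_product.emeasure_PiM borel_Times)
  also have "\<dots> = emeasure lborel (box (fst l) (fst u)) * emeasure lborel (box (snd l) (snd u))"
    by (simp add: emeasure_lborel_Times emeasure_box_vec prod.distrib)
  also have "\<dots> = emeasure lborel (box l u)"
  proof -
    have "box l u = box (fst l) (fst u) \<times> box (snd l) (snd u)"
      by (auto simp: mem_box_prod)
    then show ?thesis by (simp add: emeasure_lborel_Times)
  qed
  finally show "emeasure (distr ?P borel ?f) (box l u) = emeasure lborel (box l u)" .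
qed simp

section \<open>Shear coordinates: frequency differences and the last frequency\<close>

definition shear :: "('b::euclidean_space ^ 'i::finite) \<times> 'b \<Rightarrow> 'i option \<Rightarrow> 'b" where
  "shear p j = (case j of None \<Rightarrow> snd p | Some k \<Rightarrow> fst p $ k + snd p)"

lemma shear_simps [simp]: "shear p None = snd p" "shear p (Some k) = fst p $ k + snd p"
  by (simp_all add: shear_def)

lemma measurable_shear [measurable]:
  "(shear :: ('b::euclidean_space ^ 'i::finite) \<times> 'b \<Rightarrow> _) \<in> measurable borel (\<Pi>\<^sub>M j\<in>UNIV. lborel)"
proof (rule measurable_PiM_single')
  fix j :: "'i option"
  show "(\<lambda>p. shear p j) \<in> measurable borel (lborel :: 'b measure)"
    by (cases j) simp_all
qed (simp add: PiE_iff)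

lemma prod_UNIV_option: "(\<Prod>j\<in>(UNIV :: 'i::finite option set). f j) = f None * (\<Prod>k\<in>UNIV. f (Some k))"
  unfolding UNIV_option_conv by (subst prod.insert) (auto simp: prod.reindex)

text \<open>For each fixed last frequency \<open>v\<close> the other frequencies are a translate of
  the differences, so Tonelli and translation invariance suffice: the shear has Jacobian 1.\<close>

lemma distr_shear:
  "distr lborel (\<Pi>\<^sub>M j\<in>UNIV. lborel) (shear :: ('b::euclidean_space ^ 'i::finite) \<times> 'b \<Rightarrow> _) = (\<Pi>\<^sub>M j\<in>UNIV. lborel)"
proof (rule lborel_product.PiM_eqI)
  fix A :: "'i option \<Rightarrow> 'b set"
  assume "\<And>j. j \<in> UNIV \<Longrightarrow> A j \<in> sets lborel"
  then have A [measurable]: "\<And>j. A j \<in> sets borel" by simp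
  let ?S = "{p :: ('b ^ 'i) \<times> 'b. (\<forall>k. fst p $ k + snd p \<in> A (Some k)) \<and> snd p \<in> A None}"
  have S: "?S \<in> sets borel"
  proof -
    have "(\<lambda>p. fst p $ k + snd p) -` A (Some k) \<in> sets (borel :: (('b ^ 'i) \<times> 'b) measure)" for k
      by (rule measurable_sets_borel[OF _ A]) simp
    moreover have "snd -` A None \<in> sets (borel :: (('b ^ 'i) \<times> 'b) measure)"
      by (rule measurable_sets_borel[OF _ A]) simp
    moreover have "?S = (\<Inter>k. (\<lambda>p. fst p $ k + snd p) -` A (Some k)) \<inter> snd -` A None"
      by auto
    ultimately show ?thesis
      by (simp only:) (intro sets.Int sets.finite_INT, auto)
  qed
  have vim: "shear -` PiE UNIV A = ?S"
  proof (intro set_eqI iffI)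
    fix p assume "p \<in> ?S"
    then show "p \<in> shear -` PiE UNIV A"
      by (auto simp: PiE_iff shear_def split: option.split)
  next
    fix p assume "p \<in> shear -` PiE UNIV A"
    then have "shear p j \<in> A j" for j by (auto simp: PiE_iff)
    from this[of None] this[of "Some _"] show "p \<in> ?S" by simp
  qed
  have PiA: "PiE UNIV A \<in> sets (\<Pi>\<^sub>M j\<in>UNIV. lborel :: 'b measure)"
    by (rule sets_PiM_I_finite) auto
  have "emeasure (distr lborel (\<Pi>\<^sub>M j\<in>UNIV. lborel) shear) (PiE UNIV A) = emeasure (lborel \<Otimes>\<^sub>M lborel) ?S"
    using PiA by (simp add: emeasure_distr vim lborel_prod)
  also have "\<dots> = (\<integral>\<^sup>+p. indicator ?S p \<partial>(lborel \<Otimes>\<^sub>M lborel))"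
    by (simp add: S lborel_prod)
  also have "\<dots> = (\<integral>\<^sup>+v. \<integral>\<^sup>+\<eta>. indicator ?S (\<eta>, v) \<partial>lborel \<partial>lborel)"
    by (rule lborel_pair.nn_integral_snd[symmetric]) (simp add: S borel_prod)
  also have "\<dots> = (\<integral>\<^sup>+v. indicator (A None) v * (\<Prod>k\<in>UNIV. emeasure lborel (A (Some k))) \<partial>lborel)"
  proof (intro nn_integral_cong)
    fix v :: 'b
    let ?T = "{\<eta> :: 'b ^ 'i. \<forall>k. \<eta> $ k \<in> A (Some k)}"
    have [measurable]: "?T \<in> sets borel" by measurable
    \<comment> \<open>Adding \<open>v\<close> to every component is the translation of
      \<open>\<eta>\<close> by the constant vector \<open>\<chi> k. v\<close>.\<close>
    have "(\<integral>\<^sup>+\<eta>. indicator ?S (\<eta>, v) \<partial>lborel) = (\<integral>\<^sup>+\<eta>. indicator (A None) v * indicator ?T (\<eta> + (\<chi> k. v)) \<partial>lborel)"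
      by (intro nn_integral_cong) (auto simp: indicator_def)
    also have "\<dots> = indicator (A None) v * (\<integral>\<^sup>+\<eta>. indicator ?T (\<eta> + (\<chi> k. v)) \<partial>lborel)"
      by (rule nn_integral_cmult) measurable
    also have "(\<integral>\<^sup>+\<eta>. indicator ?T (\<eta> + (\<chi> k. v)) \<partial>lborel) = emeasure lborel ?T"
      by (subst nn_integral_lborel_translate) auto
    also have "\<dots> = (\<Prod>k\<in>UNIV. emeasure lborel (A (Some k)))"
      by (rule emeasure_lborel_vec) (rule A)
    finally show "(\<integral>\<^sup>+\<eta>. indicator ?S (\<eta>, v) \<partial>lborel) = indicator (A None) v * (\<Prod>k\<in>UNIV. emeasure lborel (A (Some k)))" .
  qed
  also have "\<dots> = emeasure lborel (A None) * (\<Prod>k\<in>UNIV. emeasure lborel (A (Some k)))"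
    by (subst nn_integral_multc) auto
  also have "\<dots> = (\<Prod>j\<in>UNIV. emeasure lborel (A j))"
    by (simp add: prod_UNIV_option)
  finally show "emeasure (distr lborel (\<Pi>\<^sub>M j\<in>UNIV. lborel) shear) (PiE UNIV A) = (\<Prod>j\<in>UNIV. emeasure lborel (A j))" .
qed simp_all

section \<open>Products of completed measures\<close>

lemma sigma_finite_lebesgue: "sigma_finite_measure (lebesgue :: 'b::euclidean_space measure)"
proof -
  obtain A :: "'b set set" where "countable A" "A \<subseteq> sets lborel" "\<Union>A = UNIV" "\<forall>a\<in>A. emeasure lborel a \<noteq> \<infinity>"
    using sigma_finite_lborel[where 'a = 'b] unfolding sigma_finite_measure_def by auto
  then show ?thesis
    unfolding sigma_finite_measure_def by (intro exI[of _ A]) auto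
qed

interpretation lebesgue_product: product_sigma_finite "\<lambda>_::'i. lebesgue :: 'b::euclidean_space measure"
  by (intro product_sigma_finite.intro sigma_finite_lebesgue)

lemma nn_integral_PiM_lebesgue:
  fixes f :: "('i::finite \<Rightarrow> 'b::euclidean_space) \<Rightarrow> ennreal"
  assumes f: "f \<in> borel_measurable (\<Pi>\<^sub>M i\<in>UNIV. lborel)"
  shows "(\<integral>\<^sup>+x. f x \<partial>(\<Pi>\<^sub>M i\<in>UNIV. lebesgue)) = (\<integral>\<^sup>+x. f x \<partial>(\<Pi>\<^sub>M i\<in>UNIV. lborel))"
proof -
  let ?L = "\<Pi>\<^sub>M i\<in>(UNIV::'i set). lebesgue :: 'b measure" and ?P = "\<Pi>\<^sub>M i\<in>(UNIV::'i set). lborel :: 'b measure"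
  have m: "(\<lambda>x. x) \<in> measurable ?L ?P"
  proof (rule measurable_PiM_single')
    fix i :: 'i
    have "(\<lambda>x. x i) \<in> measurable ?L lebesgue"
      by (rule measurable_component_singleton) simp
    then show "(\<lambda>x. x i) \<in> measurable ?L lborel"
      by (rule measurable_compose) (auto simp: measurable_def)
  qed (simp add: space_PiM)
  have "distr ?L ?P (\<lambda>x. x) = ?P"
  proof (rule lborel_product.PiM_eqI)
    fix A :: "'i \<Rightarrow> 'b set"
    assume A: "\<And>i. i \<in> UNIV \<Longrightarrow> A i \<in> sets lborel"
    have "PiE UNIV A \<in> sets ?P"
      using A by (intro sets_PiM_I_finite) auto
    moreover have "PiE UNIV A \<inter> space ?L = PiE UNIV A"
      by (auto simp: space_PiM)
    ultimately have "emeasure (distr ?L ?P (\<lambda>x. x)) (PiE UNIV A) = emeasure ?L (PiE UNIV A)"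
      by (simp add: emeasure_distr[OF m] vimage_def)
    also have "\<dots> = (\<Prod>i\<in>UNIV. emeasure lborel (A i))"
      using A by (subst lebesgue_product.emeasure_PiM) auto
    finally show "emeasure (distr ?L ?P (\<lambda>x. x)) (PiE UNIV A) = (\<Prod>i\<in>UNIV. emeasure lborel (A i))" .
  qed auto
  then show ?thesis
    using nn_integral_distr[OF m, of f] f by simp
qed

text \<open>An exceptional set in one coordinate lies in a cylinder with one factor of measure 0,
  and in [0, \<infinity>] the product vanishes even though the other factors are infinite.\<close>

lemma AE_PiM_lebesgue:
  assumes "\<And>i. AE x in lebesgue. P i (x :: 'b::euclidean_space)"
  shows "AE x in (\<Pi>\<^sub>M i\<in>(UNIV :: 'i::finite set). lebesgue). \<forall>i. P i (x i)"
proof -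
  let ?L = "\<Pi>\<^sub>M i\<in>(UNIV::'i set). lebesgue :: 'b measure"
  have "AE x in ?L. P i (x i)" for i
  proof -
    obtain N where N: "{x \<in> space lebesgue. \<not> P i x} \<subseteq> N" "N \<in> null_sets lebesgue"
      using assms[of i] by (auto elim!: AE_E simp: null_sets_def)
    let ?A = "\<lambda>j. if j = i then N else UNIV"
    have A: "?A j \<in> sets lebesgue" for j
      using N(2) by auto
    have "emeasure ?L (PiE UNIV ?A) = (\<Prod>j\<in>UNIV. emeasure lebesgue (?A j))"
      using A by (intro lebesgue_product.emeasure_PiM) auto
    also have "\<dots> = 0"
      using N(2) by (intro prod_zero) (auto intro!: exI[of _ i])
    finally have "PiE UNIV ?A \<in> null_sets ?L"
      using A by (auto intro!: null_setsI sets_PiM_I_finite)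
    then show ?thesis
      by (rule AE_I') (use N in \<open>auto simp: PiE_iff space_PiM\<close>)
  qed
  then show ?thesis
    by (simp add: AE_all_countable)
qed

subsection \<open>Oscillatory integrals and change of variables\<close>

lemma integrable_lebesgue_ex_borel:
  fixes f :: "'a::euclidean_space \<Rightarrow> complex"
  assumes f: "integrable lebesgue f"
  obtains f' where "integrable lborel f'" "AE x in lborel. f x = f' x"
proof -
  have m: "(\<lambda>x. Re (f x)) \<in> borel_measurable lebesgue" "(\<lambda>x. Im (f x)) \<in> borel_measurable lebesgue"
    using f by (auto dest: borel_measurable_integrable)
  obtain r where r: "r \<in> borel_measurable lborel" "AE x in lborel. Re (f x) = r x"
    using completion_ex_borel_measurable_real[OF m(1)] by auto
  obtain i where i: "i \<in> borel_measurable lborel" "AE x in lborel. Im (f x) = i x"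
    using completion_ex_borel_measurable_real[OF m(2)] by auto
  let ?f = "\<lambda>x. Complex (r x) (i x)"
  have ae: "AE x in lborel. f x = ?f x"
    using r(2) i(2) by eventually_elim (simp add: complex_eq_iff)
  have meas: "?f \<in> borel_measurable lborel"
    unfolding Complex_eq using r(1) i(1) by measurable
  have "integrable lebesgue ?f"
    using f by (rule integrable_cong_AE_imp) (use meas ae in \<open>auto intro: AE_completion measurable_completion\<close>)
  then have "integrable lborel ?f"
    using meas by (simp add: integrable_completion)
  with ae show thesis by (rule that[rotated])
qed

section \<open>Change of variables and Plancherel for oscillatory integrals\<close>

lemma has_absolute_integral_change_of_variables_real':
  fixes f :: "real^'m::{finite,wellorder} \<Rightarrow> real" and g :: "real^'m::_ \<Rightarrow> real^'m::_"
  assumes "S \<in> sets lebesgue"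
    and "\<forall>x\<in>S. (g has_derivative g' x) (at x within S)"
    and "inj_on g S"
  shows "(\<lambda>x. \<bar>det (matrix (g' x))\<bar> * f (g x)) absolutely_integrable_on S \<and>
           integral S (\<lambda>x. \<bar>det (matrix (g' x))\<bar> * f (g x)) = b
     \<longleftrightarrow> f absolutely_integrable_on (g ` S) \<and> integral (g ` S) f = b"
  using has_absolute_integral_change_of_variables[OF assms(1) bspec[OF assms(2)] assms(3), of "\<lambda>x. vec (f x) :: real^1" "vec b"]
  unfolding absolutely_integrable_on_1_iff integral_on_1_eq by (simp add: vec_eq_iff)

lemma
  fixes f :: "real^'m::{finite,wellorder} \<Rightarrow> 'b::euclidean_space" and g :: "real^'m::_ \<Rightarrow> real^'m::_"
  assumes S: "S \<in> sets lebesgue"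
    and g: "\<forall>x\<in>S. (g has_derivative g' x) (at x within S)"
    and inj: "inj_on g S"
  shows absolutely_integrable_change_of_variables_euclidean:
      "(\<lambda>x. \<bar>det (matrix (g' x))\<bar> *\<^sub>R f (g x)) absolutely_integrable_on S \<longleftrightarrow>
        f absolutely_integrable_on (g ` S)" (is "?L \<longleftrightarrow> ?R")
    and integral_change_of_variables_euclidean: "f absolutely_integrable_on (g ` S) \<Longrightarrow>
        integral S (\<lambda>x. \<bar>det (matrix (g' x))\<bar> *\<^sub>R f (g x)) = integral (g ` S) f"
proof -
  note cov = has_absolute_integral_change_of_variables_real'[OF S g inj]
  have cov_iff: "(\<lambda>x. \<bar>det (matrix (g' x))\<bar> * u (g x)) absolutely_integrable_on S \<longleftrightarrow> u absolutely_integrable_on (g ` S)" for u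
    using cov[of u "integral S (\<lambda>x. \<bar>det (matrix (g' x))\<bar> * u (g x))"] cov[of u "integral (g ` S) u"] by blast
  have "?L \<longleftrightarrow> (\<forall>b\<in>Basis. (\<lambda>x. \<bar>det (matrix (g' x))\<bar> * (f (g x) \<bullet> b)) absolutely_integrable_on S)"
    by (subst absolutely_integrable_componentwise_iff) simp
  also have "\<dots> \<longleftrightarrow> (\<forall>b\<in>Basis. (\<lambda>x. f x \<bullet> b) absolutely_integrable_on (g ` S))"
    using cov_iff[of "\<lambda>x. f x \<bullet> b" for b] by simp
  also have "\<dots> \<longleftrightarrow> ?R"
    by (subst absolutely_integrable_componentwise_iff) simp
  finally show iff: "?L \<longleftrightarrow> ?R" .
  assume R: ?R
  with iff have L: ?L by simp
  show "integral S (\<lambda>x. \<bar>det (matrix (g' x))\<bar> *\<^sub>R f (g x)) = integral (g ` S) f"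
  proof (rule euclidean_eqI)
    fix b :: 'b assume b: "b \<in> Basis"
    have "(\<lambda>x. f x \<bullet> b) absolutely_integrable_on (g ` S)"
      using R by (rule absolutely_integrable_component)
    with cov[of "\<lambda>x. f x \<bullet> b" "integral (g ` S) (\<lambda>x. f x \<bullet> b)"]
    have "integral S (\<lambda>x. \<bar>det (matrix (g' x))\<bar> * (f (g x) \<bullet> b)) = integral (g ` S) (\<lambda>x. f x \<bullet> b)"
      by blast
    then show "integral S (\<lambda>x. \<bar>det (matrix (g' x))\<bar> *\<^sub>R f (g x)) \<bullet> b = integral (g ` S) f \<bullet> b"
      using integral_component_eq[OF set_lebesgue_integral_eq_integral(1)[OF L], of b]
        integral_component_eq[OF set_lebesgue_integral_eq_integral(1)[OF R], of b] by simp
  qed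
qed

lemma nn_integral_not_integrable:
  fixes u :: "'a \<Rightarrow> real"
  assumes "u \<in> borel_measurable M" "\<And>x. 0 \<le> u x" "\<not> integrable M u"
  shows "(\<integral>\<^sup>+x. ennreal (u x) \<partial>M) = \<infinity>"
proof (rule ccontr)
  assume "(\<integral>\<^sup>+x. ennreal (u x) \<partial>M) \<noteq> \<infinity>"
  then have "integrable M u"
    using assms by (intro integrableI_nonneg) (auto simp: less_top[symmetric])
  with assms(3) show False ..
qed

text \<open>The oscillatory integral is the Fourier transform of the image density of
  \<open>G\<close> under \<open>\<Psi>\<close>, which is \<open>G / \<bar>J\<bar>\<close> carried
  along \<open>\<Psi>\<close>. Plancherel squares this density; changing variables back returns one
  Jacobian, leaving a single power of \<open>\<bar>J v\<bar>\<close> in the denominator.\<close>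

lemma plancherel_oscillatory:
  fixes \<Psi> :: "real^'w::{finite,wellorder} \<Rightarrow> real^'w::_" and G :: "real^'w::_ \<Rightarrow> complex"
  assumes G: "integrable lborel G"
    and \<Psi> [measurable]: "\<Psi> \<in> borel_measurable borel"
    and der: "\<And>v. G v \<noteq> 0 \<Longrightarrow> (\<Psi> has_derivative \<Psi>' v) (at v)"
    and inj: "inj_on \<Psi> {v. G v \<noteq> 0}"
    and J [measurable]: "J \<in> borel_measurable borel"
    and J_eq: "\<And>v. G v \<noteq> 0 \<Longrightarrow> \<bar>det (matrix (\<Psi>' v))\<bar> = \<bar>J v\<bar>"
    and J_nz: "\<And>v. G v \<noteq> 0 \<Longrightarrow> J v \<noteq> 0"
  shows "(\<integral>\<^sup>+T. ennreal ((cmod (\<integral>v. cis (T \<bullet> \<Psi> v) * G v \<partial>lborel))\<^sup>2) \<partial>lborel) =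
    ennreal ((2 * pi) ^ CARD('w)) * (\<integral>\<^sup>+v. ennreal ((cmod (G v))\<^sup>2 / \<bar>J v\<bar>) \<partial>lborel)"
proof -
  have [measurable]: "G \<in> borel_measurable borel"
    using G by (auto dest: borel_measurable_integrable)
  define S where "S = {v. G v \<noteq> 0}"
  have "S \<in> sets borel" unfolding S_def by measurable
  then have S: "S \<in> sets lebesgue" by simp
  have der': "\<forall>v\<in>S. (\<Psi> has_derivative \<Psi>' v) (at v within S)"
    using der by (auto simp: S_def intro: has_derivative_at_withinI)
  have inj': "inj_on \<Psi> S"
    using inj by (simp add: S_def)
  note cov = S der' inj'
  \<comment> \<open>Injectivity is only known where \<open>G\<close> is nonzero, so the inverse is
    taken on \<open>S\<close> and the density is extended by 0 off its image.\<close>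
  define h where "h = (\<lambda>s. if s \<in> \<Psi> ` S then G (the_inv_into S \<Psi> s) / complex_of_real \<bar>J (the_inv_into S \<Psi> s)\<bar> else 0)"
  have h: "h (\<Psi> v) = G v / complex_of_real \<bar>J v\<bar>" if "v \<in> S" for v
    using that by (simp add: h_def the_inv_into_f_f[OF inj'])
  have h0: "h s = 0" if "s \<notin> \<Psi> ` S" for s
    using that by (simp add: h_def)
  have wave: "integrable lebesgue (\<lambda>s. cis (T \<bullet> s) * h s)" (is ?I)
     "(\<integral>s. cis (T \<bullet> s) * h s \<partial>lebesgue) = (\<integral>v. cis (T \<bullet> \<Psi> v) * G v \<partial>lborel)" (is ?E) for T
  proof -
    let ?f = "\<lambda>s. cis (T \<bullet> s) * h s" and ?k = "\<lambda>v. cis (T \<bullet> \<Psi> v) * G v"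
    have k: "integrable lborel ?k"
      by (rule integrable_cis_mult[OF G]) measurable
    then have kl: "integrable lebesgue ?k" "integral\<^sup>L lebesgue ?k = integral\<^sup>L lborel ?k"
      by (simp_all add: integrable_completion integral_completion borel_measurable_integrable)
    have ind_k: "(\<lambda>v. indicator S v *\<^sub>R (\<bar>det (matrix (\<Psi>' v))\<bar> *\<^sub>R ?f (\<Psi> v))) = ?k"
      using J_nz by (auto simp: fun_eq_iff indicator_def S_def h[unfolded S_def] J_eq scaleR_conv_of_real)
    have ind_f: "(\<lambda>s. indicator (\<Psi> ` S) s *\<^sub>R ?f s) = ?f"
      by (auto simp: fun_eq_iff indicator_def h0)
    have 1: "(\<lambda>v. \<bar>det (matrix (\<Psi>' v))\<bar> *\<^sub>R ?f (\<Psi> v)) absolutely_integrable_on S"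
      unfolding set_integrable_def ind_k by (rule kl)
    then have 2: "?f absolutely_integrable_on (\<Psi> ` S)"
      by (subst (asm) absolutely_integrable_change_of_variables_euclidean[OF cov])
    then show ?I
      unfolding set_integrable_def ind_f .
    have "integral\<^sup>L lebesgue ?f = integral (\<Psi> ` S) ?f"
      using set_lebesgue_integral_eq_integral(2)[OF 2] unfolding set_lebesgue_integral_def ind_f .
    also have "\<dots> = integral S (\<lambda>v. \<bar>det (matrix (\<Psi>' v))\<bar> *\<^sub>R ?f (\<Psi> v))"
      by (rule integral_change_of_variables_euclidean[OF cov 2, symmetric])
    also have "\<dots> = integral\<^sup>L lebesgue ?k"
      using set_lebesgue_integral_eq_integral(2)[OF 1] unfolding set_lebesgue_integral_def ind_k by simp
    finally show ?E
      by (simp add: kl)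
  qed
  \<comment> \<open>The case \<open>T = 0\<close> also yields the measurability of \<open>h\<close>,
    but only for the completed measure; hence the passage to a Borel representative
    \<open>h'\<close>.\<close>
  have h_int: "integrable lebesgue h"
    using wave(1)[of 0] by simp
  obtain h' where h': "integrable lborel h'" "AE s in lborel. h s = h' s"
    using integrable_lebesgue_ex_borel[OF h_int] .
  have [measurable]: "h' \<in> borel_measurable borel"
    using h'(1) by (auto dest: borel_measurable_integrable)
  have fourier_h': "fourier h' T = (\<integral>v. cis (T \<bullet> \<Psi> v) * G v \<partial>lborel)" for T
  proof -
    have "fourier h' T = (\<integral>s. cis (T \<bullet> s) * h' s \<partial>lebesgue)"
      unfolding fourier_def by (rule integral_completion[symmetric]) measurable
    also have "\<dots> = (\<integral>s. cis (T \<bullet> s) * h s \<partial>lebesgue)"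
    proof (rule integral_cong_AE)
      show "AE s in lebesgue. cis (T \<bullet> s) * h' s = cis (T \<bullet> s) * h s"
        using AE_completion[OF h'(2)] by eventually_elim simp
      show "(\<lambda>s. cis (T \<bullet> s) * h' s) \<in> borel_measurable lebesgue"
        by (rule measurable_completion) measurable
    qed (use wave(1) in \<open>auto dest: borel_measurable_integrable\<close>)
    finally show ?thesis by (simp add: wave(2))
  qed
  let ?u = "\<lambda>s. (cmod (h s))\<^sup>2" and ?q = "\<lambda>v. (cmod (G v))\<^sup>2 / \<bar>J v\<bar>"
  have um: "?u \<in> borel_measurable lebesgue"
    using h_int by (auto dest: borel_measurable_integrable)
  have qm: "?q \<in> borel_measurable lebesgue"
    by (rule measurable_completion) measurable
  have sq: "a * (x / a)\<^sup>2 = x\<^sup>2 / a" if "a \<noteq> 0" for a x :: real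
    using that by (simp add: power2_eq_square)
  have ind_q: "(\<lambda>v. indicator S v *\<^sub>R (\<bar>det (matrix (\<Psi>' v))\<bar> *\<^sub>R ?u (\<Psi> v))) = ?q"
    using J_nz by (auto simp: fun_eq_iff indicator_def S_def h[unfolded S_def] J_eq norm_divide sq)
  have ind_u: "(\<lambda>s. indicator (\<Psi> ` S) s *\<^sub>R ?u s) = ?u"
    by (auto simp: fun_eq_iff indicator_def h0)
  \<comment> \<open>The change of variables transfers integrability in both directions. In the
    non-integrable case both integrals are therefore infinite, and no finiteness of the L^2 norm is
    needed.\<close>
  have "(\<integral>\<^sup>+s. ennreal (?u s) \<partial>lebesgue) = (\<integral>\<^sup>+v. ennreal (?q v) \<partial>lebesgue)"
  proof (cases "integrable lebesgue ?u")
    case True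
    then have 2: "?u absolutely_integrable_on (\<Psi> ` S)"
      unfolding set_integrable_def ind_u .
    then have 1: "(\<lambda>v. \<bar>det (matrix (\<Psi>' v))\<bar> *\<^sub>R ?u (\<Psi> v)) absolutely_integrable_on S"
      by (subst absolutely_integrable_change_of_variables_euclidean[OF cov])
    then have q: "integrable lebesgue ?q"
      unfolding set_integrable_def ind_q .
    have "integral\<^sup>L lebesgue ?u = integral (\<Psi> ` S) ?u"
      using set_lebesgue_integral_eq_integral(2)[OF 2] unfolding set_lebesgue_integral_def ind_u .
    also have "\<dots> = integral S (\<lambda>v. \<bar>det (matrix (\<Psi>' v))\<bar> *\<^sub>R ?u (\<Psi> v))"
      by (rule integral_change_of_variables_euclidean[OF cov 2, symmetric])
    also have "\<dots> = integral\<^sup>L lebesgue ?q"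
      using set_lebesgue_integral_eq_integral(2)[OF 1] unfolding set_lebesgue_integral_def ind_q by simp
    finally show ?thesis
      using True q by (simp add: nn_integral_eq_integral)
  next
    case False
    have "\<not> integrable lebesgue ?q"
    proof
      assume "integrable lebesgue ?q"
      then have "(\<lambda>v. \<bar>det (matrix (\<Psi>' v))\<bar> *\<^sub>R ?u (\<Psi> v)) absolutely_integrable_on S"
        unfolding set_integrable_def ind_q .
      then have "?u absolutely_integrable_on (\<Psi> ` S)"
        by (subst (asm) absolutely_integrable_change_of_variables_euclidean[OF cov])
      then show False
        using False unfolding set_integrable_def ind_u by simp
    qed
    with False show ?thesis
      by (simp add: nn_integral_not_integrable um qm)
  qed
  moreover have "(\<integral>\<^sup>+s. ennreal (?u s) \<partial>lebesgue) = (\<integral>\<^sup>+s. ennreal ((cmod (h' s))\<^sup>2) \<partial>lborel)"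
    unfolding nn_integral_completion using h'(2) by (intro nn_integral_cong_AE) auto
  ultimately show ?thesis
    using plancherel[OF h'(1)] by (simp add: fourier_h' nn_integral_completion)
qed

section \<open>Transfer to arbitrary finite index types\<close>

definition relabel :: "real ^ 'm wellordered \<Rightarrow> real ^ 'm::finite" where
  "relabel w = (\<chi> k. w $ WO k)"

definition unlabel :: "real ^ 'm::finite \<Rightarrow> real ^ 'm wellordered" where
  "unlabel v = (\<chi> i. v $ un_WO i)"

lemma relabel_unlabel [simp]: "relabel (unlabel v) = v" "unlabel (relabel w) = w"
  by (simp_all add: relabel_def unlabel_def vec_eq_iff)

lemma bij_un_WO: "bij (un_WO :: 'm wellordered \<Rightarrow> 'm)"
  by (rule o_bij[of WO]) (auto simp: fun_eq_iff)

lemma inner_unlabel: "unlabel v \<bullet> unlabel w = v \<bullet> w"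
  unfolding unlabel_def inner_vec_def
  using sum.reindex_bij_betw[OF bij_un_WO, of "\<lambda>i. v $ i * w $ i"] by simp

lemma linear_relabel: "linear relabel" and linear_unlabel: "linear unlabel"
  by (auto intro!: linearI simp: relabel_def unlabel_def vec_eq_iff)

lemma card_wellordered: "CARD('m wellordered) = CARD('m::finite)"
  by (rule bij_betw_same_card[OF bij_un_WO])

lemma measurable_relabel [measurable]: "relabel \<in> borel_measurable borel"
  unfolding relabel_def by measurable

lemma measurable_unlabel [measurable]: "unlabel \<in> borel_measurable borel"
  unfolding unlabel_def by measurable

lemma all_wellordered: "(\<forall>j. P j) \<longleftrightarrow> (\<forall>k. P (WO k))"
  by (metis wellordered.exhaust)

lemma distr_relabel: "distr lborel borel relabel = (lborel :: (real ^ 'm::finite) measure)"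
proof (rule lborel_eq_boxI)
  fix l u :: "real ^ 'm"
  have "relabel -` box l u = box (unlabel l) (unlabel u)"
    by (auto simp: mem_box_vec relabel_def unlabel_def all_wellordered)
  then have "emeasure (distr lborel borel relabel) (box l u) = emeasure lborel (box (unlabel l) (unlabel u))"
    by (simp add: emeasure_distr)
  also have "\<dots> = (\<Prod>i\<in>UNIV. emeasure lborel (box (l $ un_WO i) (u $ un_WO i)))"
    by (simp add: emeasure_box_vec unlabel_def)
  also have "\<dots> = emeasure lborel (box l u)"
    unfolding emeasure_box_vec
    using prod.reindex_bij_betw[OF bij_un_WO, of "\<lambda>i. emeasure lborel (box (l $ i) (u $ i))"] by simp
  finally show "emeasure (distr lborel borel relabel) (box l u) = emeasure lborel (box l u)" .
qed simp

lemma nn_integral_relabel: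
  "f \<in> borel_measurable borel \<Longrightarrow> (\<integral>\<^sup>+w. f (relabel w) \<partial>lborel) = (\<integral>\<^sup>+v. f v \<partial>lborel)"
  by (subst distr_relabel[symmetric]) (simp add: nn_integral_distr)

lemma integral_relabel:
  fixes f :: "real ^ 'm::finite \<Rightarrow> complex"
  shows "f \<in> borel_measurable borel \<Longrightarrow> (\<integral>w. f (relabel w) \<partial>lborel) = (\<integral>v. f v \<partial>lborel)"
  by (subst distr_relabel[symmetric]) (simp add: integral_distr)

text \<open>Conjugation by \<open>relabel\<close> preserves inner products and Lebesgue measure. The
  Jacobian condition keeps the wellordered indices, which is the form delivered by
  \<open>det_gradient_matrix_reduce\<close>.\<close>

lemma plancherel_oscillatory_finite:
  fixes \<Psi> :: "real^'m::finite \<Rightarrow> real^'m::finite" and G :: "real^'m::finite \<Rightarrow> complex"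
  assumes G: "integrable lborel G"
    and \<Psi> [measurable]: "\<Psi> \<in> borel_measurable borel"
    and der: "\<And>v. G v \<noteq> 0 \<Longrightarrow> (\<Psi> has_derivative \<Psi>' v) (at v)"
    and inj: "inj_on \<Psi> {v. G v \<noteq> 0}"
    and J [measurable]: "J \<in> borel_measurable borel"
    and J_eq: "\<And>v. G v \<noteq> 0 \<Longrightarrow>
      \<bar>det (\<chi> i j :: 'm wellordered. \<Psi>' v (axis (un_WO j) 1) $ un_WO i)\<bar> = \<bar>J v\<bar>"
    and J_nz: "\<And>v. G v \<noteq> 0 \<Longrightarrow> J v \<noteq> 0"
  shows "(\<integral>\<^sup>+T. ennreal ((cmod (\<integral>v. cis (T \<bullet> \<Psi> v) * G v \<partial>lborel))\<^sup>2) \<partial>lborel) =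
    ennreal ((2 * pi) ^ CARD('m)) * (\<integral>\<^sup>+v. ennreal ((cmod (G v))\<^sup>2 / \<bar>J v\<bar>) \<partial>lborel)"
proof -
  have [measurable]: "G \<in> borel_measurable borel"
    using G by (auto dest: borel_measurable_integrable)
  let ?\<Psi> = "\<lambda>w. unlabel (\<Psi> (relabel w))" and ?\<Psi>' = "\<lambda>w x. unlabel (\<Psi>' (relabel w) (relabel x))"
  have 1: "integrable lborel (\<lambda>w. G (relabel w))"
    using G distr_relabel[where 'm = 'm] integrable_distr[of relabel lborel borel G] by simp
  have 3: "(?\<Psi> has_derivative ?\<Psi>' w) (at w)" if "G (relabel w) \<noteq> 0" for w
  proof -
    have r: "(relabel has_derivative relabel) (at w)"
      using linear_relabel by (rule linear_imp_has_derivative)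
    have u: "(unlabel has_derivative unlabel) (at (\<Psi> (relabel w)))"
      using linear_unlabel by (rule linear_imp_has_derivative)
    show ?thesis
      using diff_chain_at[OF diff_chain_at[OF r der[OF that]], of unlabel unlabel] u
      by (simp add: o_def)
  qed
  have 4: "inj_on ?\<Psi> {w. G (relabel w) \<noteq> 0}"
  proof (rule inj_onI)
    fix w w' assume a: "w \<in> {w. G (relabel w) \<noteq> 0}" "w' \<in> {w. G (relabel w) \<noteq> 0}" "?\<Psi> w = ?\<Psi> w'"
    then have "\<Psi> (relabel w) = \<Psi> (relabel w')"
      by (metis relabel_unlabel(1))
    then have "relabel w = relabel w'"
      using a inj by (auto dest: inj_onD)
    then show "w = w'"
      by (metis relabel_unlabel(2))
  qed
  have 6: "\<bar>det (matrix (?\<Psi>' w))\<bar> = \<bar>J (relabel w)\<bar>" if "G (relabel w) \<noteq> 0" for w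
  proof -
    have r: "relabel (axis j 1) = axis (un_WO j) 1" for j :: "'m wellordered"
      by (cases j) (simp add: relabel_def axis_def vec_eq_iff)
    show ?thesis
      using J_eq[OF that] by (simp add: matrix_def r unlabel_def)
  qed
  have main: "(\<integral>\<^sup>+T. ennreal ((cmod (\<integral>w. cis (T \<bullet> ?\<Psi> w) * G (relabel w) \<partial>lborel))\<^sup>2) \<partial>lborel) =
    ennreal ((2 * pi) ^ CARD('m wellordered)) * (\<integral>\<^sup>+w. ennreal ((cmod (G (relabel w)))\<^sup>2 / \<bar>J (relabel w)\<bar>) \<partial>lborel)"
    by (rule plancherel_oscillatory[OF 1 _ 3 4 _ 6]) (use J_nz in auto)
  have L: "(\<integral>w. cis (T \<bullet> ?\<Psi> w) * G (relabel w) \<partial>lborel) = (\<integral>v. cis (relabel T \<bullet> \<Psi> v) * G v \<partial>lborel)" for T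
  proof -
    have "T \<bullet> unlabel v = relabel T \<bullet> v" for v
      using inner_unlabel[of "relabel T" v] by simp
    then show ?thesis
      using integral_relabel[of "\<lambda>v. cis (relabel T \<bullet> \<Psi> v) * G v"] by simp
  qed
  have "(\<lambda>T. ennreal ((cmod (\<integral>v. cis (T \<bullet> \<Psi> v) * G v \<partial>lborel))\<^sup>2)) \<in> borel_measurable borel"
    by measurable
  from nn_integral_relabel[OF this]
  have R1: "(\<integral>\<^sup>+T. ennreal ((cmod (\<integral>v. cis (relabel T \<bullet> \<Psi> v) * G v \<partial>lborel))\<^sup>2) \<partial>lborel) =
    (\<integral>\<^sup>+T. ennreal ((cmod (\<integral>v. cis (T \<bullet> \<Psi> v) * G v \<partial>lborel))\<^sup>2) \<partial>lborel)" .
  have "(\<lambda>v. ennreal ((cmod (G v))\<^sup>2 / \<bar>J v\<bar>)) \<in> borel_measurable borel"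
    by measurable
  from nn_integral_relabel[OF this]
  have R2: "(\<integral>\<^sup>+w. ennreal ((cmod (G (relabel w)))\<^sup>2 / \<bar>J (relabel w)\<bar>) \<partial>lborel) =
    (\<integral>\<^sup>+v. ennreal ((cmod (G v))\<^sup>2 / \<bar>J v\<bar>) \<partial>lborel)" .
  show ?thesis
    using main unfolding L card_wellordered R1 R2 .
qed

subsection \<open>Gradient matrices\<close>

text \<open>Induction over single row operations; row \<open>i0\<close> lies outside
  \<open>T\<close> and so is still intact at every stage.\<close>

lemma det_subtract_row:
  fixes A :: "real ^ 'n ^ 'n::finite"
  assumes "finite T" "i0 \<notin> T"
  shows "det (\<chi> i. if i \<in> T then row i A - row i0 A else row i A) = det A"
  using assms
proof (induction T rule: finite_induct)
  case empty
  then show ?case by (simp add: row_def)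
next
  case (insert a T)
  let ?B = "\<chi> i. if i \<in> T then row i A - row i0 A else row i A"
  have eq: "(\<chi> i. if i \<in> insert a T then row i A - row i0 A else row i A) =
      (\<chi> k. if k = a then row a ?B + (-1) *s row i0 ?B else row k ?B)"
    using insert by (auto simp: vec_eq_iff row_def)
  have "a \<noteq> i0" using insert by auto
  from det_row_operation[OF this, of ?B "-1"]
  have "det (\<chi> i. if i \<in> insert a T then row i A - row i0 A else row i A) = det ?B"
    unfolding eq .
  also have "\<dots> = det A" using insert by auto
  finally show ?case .
qed

text \<open>Laplace expansion along the unit column \<open>None\<close>, carried out in the Leibniz
  formula so that the remaining indices can be renamed by \<open>f\<close> at the same time.\<close>

lemma det_reindex_option:
  fixes C :: "real ^ 'm option ^ 'm::finite option" and f :: "'w::finite \<Rightarrow> 'm option"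
  assumes f: "bij_betw f UNIV (- {None})"
    and C1: "C $ None $ None = 1" and C0: "\<And>k. C $ Some k $ None = 0"
  shows "det C = det (\<chi> i j. C $ f i $ f j)"
proof -
  let ?B = "- {None} :: 'm option set"
  let ?S = "{p. p permutes (UNIV :: 'm option set)}" and ?R = "{p. p permutes ?B}"
  let ?t = "\<lambda>p. of_int (sign p) * (\<Prod>j\<in>UNIV. C $ j $ p j)"
  let ?F = "\<lambda>\<pi> x. if x \<in> ?B then f (\<pi> (inv_into UNIV f x)) else x"
  have inj: "inj f" and ran: "range f = ?B"
    using f by (auto simp: bij_betw_def)
  have "det C = sum ?t ?S"
    by (simp add: det_def)
  also have "\<dots> = sum ?t ?R"
  \<comment> \<open>A permutation that moves \<open>None\<close> sends some \<open>Some k\<close> to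
    \<open>None\<close>, and so picks up a zero entry of that column.\<close>
  proof (rule sum.mono_neutral_right)
    show "?R \<subseteq> ?S" by (auto intro: permutes_subset)
    show "\<forall>p\<in>?S - ?R. ?t p = 0"
    proof
      fix p assume p: "p \<in> ?S - ?R"
      then have perm: "p permutes UNIV" by simp
      have "p None \<noteq> None"
      proof
        assume "p None = None"
        then have "p permutes ?B"
          by (intro permutes_superset[OF perm]) auto
        with p show False by simp
      qed
      moreover obtain j where j: "p j = None"
        using permutes_surj[OF perm] by (metis surjD)
      ultimately obtain k where "j = Some k"
        by (cases j) auto
      with j C0 have "C $ j $ p j = 0" by simp
      then have "(\<Prod>j\<in>UNIV. C $ j $ p j) = 0"
        by (intro prod_zero) auto
      then show "?t p = 0" by simp
    qed
  qed (simp add: finite_permutations)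
  also have "\<dots> = (\<Sum>\<pi>\<in>{\<pi>. \<pi> permutes (UNIV :: 'w set)}. ?t (?F \<pi>))"
    by (rule sum.reindex_bij_betw[OF bij_betw_permutations[OF f], symmetric])
  also have "\<dots> = (\<Sum>\<pi>\<in>{\<pi>. \<pi> permutes (UNIV :: 'w set)}. of_int (sign \<pi>) * (\<Prod>i\<in>UNIV. C $ f i $ f (\<pi> i)))"
  proof (intro sum.cong refl)
    fix \<pi> assume "\<pi> \<in> {\<pi>. \<pi> permutes (UNIV :: 'w set)}"
    then have \<pi>: "\<pi> permutes UNIV" by simp
    \<comment> \<open>Transport along an injection preserves the sign, since rows and columns are
      renamed simultaneously.\<close>
    have "?F \<pi> = map_permutation UNIV f \<pi>"
      by (auto simp: map_permutation_def restrict_id_def ran fun_eq_iff)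
    then have sgn: "sign (?F \<pi>) = sign \<pi>"
      using sign_map_permutation[OF inj \<pi>] by simp
    have U: "(UNIV :: 'm option set) = insert None ?B" by auto
    have "(\<Prod>j\<in>UNIV. C $ j $ ?F \<pi> j) = (\<Prod>j\<in>?B. C $ j $ ?F \<pi> j)"
      by (subst U, subst prod.insert) (auto simp: C1)
    also have "\<dots> = (\<Prod>i\<in>UNIV. C $ f i $ ?F \<pi> (f i))"
      by (rule prod.reindex_bij_betw[OF f, symmetric])
    also have "\<dots> = (\<Prod>i\<in>UNIV. C $ f i $ f (\<pi> i))"
      using ran inj by (intro prod.cong refl) (auto simp: inv_f_f)
    finally show "?t (?F \<pi>) = of_int (sign \<pi>) * (\<Prod>i\<in>UNIV. C $ f i $ f (\<pi> i))"
      by (simp only: sgn)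
  qed
  also have "\<dots> = det (\<chi> i j. C $ f i $ f j)"
    by (simp add: det_def)
  finally show ?thesis .
qed

text \<open>Transposing puts the gradients in rows; subtracting row \<open>None\<close> from the
  others clears the column of ones. What remains is the Jacobian matrix of
  \<open>phase_differences\<close>, with phases as rows and directions as columns.\<close>

lemma det_gradient_matrix_reduce:
  fixes \<phi> :: "'m::finite option \<Rightarrow> real ^ 'm \<Rightarrow> real"
  shows "det (gradient_matrix \<phi> \<xi>) =
    det (\<chi> i j :: 'm wellordered. gradient (\<phi> (Some (un_WO i))) (\<xi> (Some (un_WO i))) $ un_WO j
      - gradient (\<phi> None) (\<xi> None) $ un_WO j)"
proof -
  let ?A = "transpose (gradient_matrix \<phi> \<xi>)"
  let ?C = "\<chi> i. if i \<in> - {None} then row i ?A - row None ?A else row i ?A"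
  have "bij_betw Some UNIV (- {None :: 'm option})"
    by (auto simp: bij_betw_def notin_range_Some)
  from bij_betw_trans[OF bij_un_WO this]
  have f: "bij_betw (Some \<circ> un_WO) UNIV (- {None :: 'm option})" .
  have "det (gradient_matrix \<phi> \<xi>) = det ?C"
    by (subst det_subtract_row) simp_all
  also have "\<dots> = det (\<chi> i j :: 'm wellordered. ?C $ (Some \<circ> un_WO) i $ (Some \<circ> un_WO) j)"
    by (rule det_reindex_option[OF f]) (simp_all add: row_def transpose_def gradient_matrix_def)
  also have "(\<chi> i j :: 'm wellordered. ?C $ (Some \<circ> un_WO) i $ (Some \<circ> un_WO) j) =
    (\<chi> i j. gradient (\<phi> (Some (un_WO i))) (\<xi> (Some (un_WO i))) $ un_WO j - gradient (\<phi> None) (\<xi> None) $ un_WO j)"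
    by (simp add: vec_eq_iff row_def transpose_def gradient_matrix_def)
  finally show ?thesis .
qed

section \<open>Smooth phases and the mean value theorem\<close>

lemma smooth_imp_differentiable: "smooth f \<Longrightarrow> f differentiable (at x)"
  unfolding smooth_def by (metis times_cont_diff.simps(2))

lemma smooth_imp_has_derivative: "smooth f \<Longrightarrow> (f has_derivative frechet_derivative f (at x)) (at x)"
  using smooth_imp_differentiable frechet_derivative_works by blast

lemma smooth_imp_continuous: "smooth f \<Longrightarrow> continuous_on UNIV f"
  unfolding smooth_def by (metis times_cont_diff.simps(1))

lemma smooth_imp_borel [measurable_dest]: "smooth f \<Longrightarrow> f \<in> borel_measurable borel"
  by (intro borel_measurable_continuous_onI smooth_imp_continuous)

lemma smooth_frechet_derivative_borel:
  assumes "smooth f"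
  shows "(\<lambda>x. frechet_derivative f (at x) v) \<in> borel_measurable borel"
proof -
  have "times_cont_diff (Suc 0) f"
    using assms unfolding smooth_def by blast
  then show ?thesis
    by (intro borel_measurable_continuous_onI) simp
qed

lemma frechet_derivative_eq_gradient:
  fixes f :: "real ^ 'm::finite \<Rightarrow> real"
  assumes "smooth f"
  shows "frechet_derivative f (at x) w = (\<Sum>k\<in>UNIV. gradient f x $ k * w $ k)"
proof -
  have "linear (frechet_derivative f (at x))"
    using smooth_imp_has_derivative[OF assms] by (rule has_derivative_linear)
  then have "frechet_derivative f (at x) (\<Sum>k\<in>UNIV. w $ k *\<^sub>R axis k 1) =
      (\<Sum>k\<in>UNIV. w $ k * frechet_derivative f (at x) (axis k 1))"
    by (simp add: linear_sum linear_cmul)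
  then show ?thesis
    by (simp add: basis_expansion[where 'a = real, unfolded scalar_mult_eq_scaleR] gradient_def mult.commute)
qed

lemma gradient_mean_value:
  fixes f :: "real ^ 'm::finite \<Rightarrow> real"
  assumes "smooth f"
  obtains z where "z \<in> closed_segment x (x + w)" "f (x + w) - f x = (\<Sum>k\<in>UNIV. gradient f z $ k * w $ k)"
proof -
  let ?g = "\<lambda>t. f (x + t *\<^sub>R w)"
  have der: "(?g has_derivative (\<lambda>s. frechet_derivative f (at (x + t *\<^sub>R w)) (s *\<^sub>R w))) (at t)" for t
  proof -
    have "((\<lambda>t. x + t *\<^sub>R w) has_derivative (\<lambda>s. s *\<^sub>R w)) (at t)"
      by (auto intro!: derivative_eq_intros)
    from diff_chain_at[OF this smooth_imp_has_derivative[OF assms]]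
    show ?thesis by (simp add: o_def)
  qed
  have "continuous_on {0..1} ?g"
    using der by (intro has_derivative_continuous_on) (auto intro: has_derivative_at_withinI)
  from mvt[of 0 1 ?g, OF _ this der]
  obtain t where t: "0 < t" "t < 1" "f (x + w) - f x = frechet_derivative f (at (x + t *\<^sub>R w)) w"
    by auto
  show thesis
  proof (rule that)
    show "x + t *\<^sub>R w \<in> closed_segment x (x + w)"
      unfolding closed_segment_def using t by (auto intro!: exI[of _ t] simp: algebra_simps)
    show "f (x + w) - f x = (\<Sum>k\<in>UNIV. gradient f (x + t *\<^sub>R w) $ k * w $ k)"
      using t(3) by (simp add: frechet_derivative_eq_gradient[OF assms])
  qed
qed

text \<open>By the mean value theorem a nonzero common displacement \<open>w\<close> along which all phases change by
  the same amount \<open>c\<close> gives the left null vector \<open>(-c, w)\<close> of a gradient matrix.\<close>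

lemma common_displacement_eq_0:
  fixes \<phi> :: "'m::finite option \<Rightarrow> real ^ 'm \<Rightarrow> real"
  assumes smooth: "\<And>j. smooth (\<phi> j)"
    and det: "\<And>\<zeta>. (\<forall>j. \<zeta> j \<in> C j) \<Longrightarrow> det (gradient_matrix \<phi> \<zeta>) \<noteq> 0"
    and C: "\<And>j. convex (C j)" "\<And>j. \<xi> j \<in> C j" "\<And>j. \<xi> j + w \<in> C j"
    and c: "\<And>j. \<phi> j (\<xi> j + w) - \<phi> j (\<xi> j) = c"
  shows "w = 0"
proof -
  \<comment> \<open>Convexity keeps the mean value point of each index inside \<open>C j\<close>,
    where the determinant condition applies. The points are chosen independently for each
    \<open>j\<close>.\<close>
  have "\<exists>z. z \<in> C j \<and> c = (\<Sum>k\<in>UNIV. gradient (\<phi> j) z $ k * w $ k)" for j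
    using gradient_mean_value[OF smooth, of "\<xi> j" w j] c[of j] closed_segment_subset[OF C(2) C(3) C(1), of j]
    by blast
  then obtain \<zeta> where \<zeta>: "\<And>j. \<zeta> j \<in> C j" "\<And>j. c = (\<Sum>k\<in>UNIV. gradient (\<phi> j) (\<zeta> j) $ k * w $ k)"
    by metis
  let ?u = "\<chi> i. case i of None \<Rightarrow> - c | Some k \<Rightarrow> w $ k"
  have "(transpose (gradient_matrix \<phi> \<zeta>) *v ?u) $ j = 0" for j
  proof -
    have "(transpose (gradient_matrix \<phi> \<zeta>) *v ?u) $ j = - c + (\<Sum>k\<in>UNIV. gradient (\<phi> j) (\<zeta> j) $ k * w $ k)"
      unfolding matrix_vector_mult_def transpose_def gradient_matrix_def UNIV_option_conv
      by (subst sum.insert) (auto simp: sum.reindex)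
    then show ?thesis using \<zeta>(2)[of j] by simp
  qed
  then have "transpose (gradient_matrix \<phi> \<zeta>) *v ?u = 0"
    by (simp add: vec_eq_iff)
  moreover have "det (transpose (gradient_matrix \<phi> \<zeta>)) \<noteq> 0"
    using det \<zeta>(1) by simp
  then have "inj ((*v) (transpose (gradient_matrix \<phi> \<zeta>)))"
    by (simp add: inj_matrix_vector_mult invertible_det_nz)
  ultimately have "?u = 0"
    by (metis injD matrix_vector_mult_0_right)
  then have "?u $ Some k = 0" for k by simp
  then show "w = 0"
    by (simp add: vec_eq_iff)
qed

lemma borel_measurable_det:
  fixes A :: "'a \<Rightarrow> real ^ 'n ^ 'n::finite"
  assumes [measurable]: "\<And>i j. (\<lambda>x. A x $ i $ j) \<in> borel_measurable M"
  shows "(\<lambda>x. det (A x)) \<in> borel_measurable M"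
  unfolding det_def by measurable

lemma borel_measurable_det_gradient_matrix:
  fixes \<phi> :: "'m::finite option \<Rightarrow> real ^ 'm \<Rightarrow> real"
  assumes "\<And>j. smooth (\<phi> j)"
  shows "(\<lambda>\<xi>. det (gradient_matrix \<phi> \<xi>)) \<in> borel_measurable (\<Pi>\<^sub>M j\<in>UNIV. lborel)"
proof (rule borel_measurable_det)
  fix i j
  have "(\<lambda>\<xi>. frechet_derivative (\<phi> j) (at (\<xi> j)) v) \<in> borel_measurable (\<Pi>\<^sub>M j\<in>UNIV. lborel)" for v
  proof -
    have 1: "(\<lambda>\<xi>. \<xi> j) \<in> measurable (\<Pi>\<^sub>M j\<in>UNIV. lborel) (lborel :: (real ^ 'm) measure)"
      by (rule measurable_component_singleton) simp
    have 2: "(\<lambda>x. frechet_derivative (\<phi> j) (at x) v) \<in> borel_measurable lborel"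
      using smooth_frechet_derivative_borel[OF assms] by simp
    show ?thesis
      by (rule measurable_compose[OF 1 2])
  qed
  then show "(\<lambda>\<xi>. gradient_matrix \<phi> \<xi> $ i $ j) \<in> borel_measurable (\<Pi>\<^sub>M j\<in>UNIV. lborel)"
    by (cases i) (simp_all add: gradient_matrix_def gradient_def)
qed

subsection \<open>Convolutions of extensions\<close>

text \<open>The Borel counterpart of \<open>extension_operator\<close>, to which Fubini over
  products of \<open>lborel\<close> applies.\<close>

definition extension :: "(real ^ 'm \<Rightarrow> real) \<Rightarrow> (real ^ 'm::finite \<Rightarrow> complex) \<Rightarrow> (real ^ 'm) \<times> real \<Rightarrow> complex" where
  "extension \<phi> g x = (\<integral>\<xi>. cis (fst x \<bullet> \<xi> + snd x * \<phi> \<xi>) * g \<xi> \<partial>lborel)"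

lemma borel_measurable_extension [measurable]:
  assumes [measurable]: "\<phi> \<in> borel_measurable borel" "g \<in> borel_measurable borel"
  shows "extension \<phi> g \<in> borel_measurable borel"
  unfolding extension_def by measurable

text \<open>With \<open>\<eta>\<close> frozen, this is the frequency paired with the vector of last
  coordinates.\<close>

definition phase_differences :: "('m::finite option \<Rightarrow> real ^ 'm \<Rightarrow> real) \<Rightarrow> (real ^ 'm) ^ 'm \<Rightarrow> real ^ 'm \<Rightarrow> real ^ 'm" where
  "phase_differences \<phi> \<eta> v = (\<chi> k. \<phi> (Some k) (\<eta> $ k + v) - \<phi> None v)"

lemma nfold_convolution_eq_lborel:
  fixes F :: "'m::finite option \<Rightarrow> ('b::euclidean_space \<times> 'c::euclidean_space) \<Rightarrow> ennreal"
  assumes [measurable]: "\<And>j. F j \<in> borel_measurable borel"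
  shows "nfold_convolution F y =
    (\<integral>\<^sup>+(X, T). (\<Prod>k\<in>UNIV. F (Some k) (X $ k, T $ k)) *
       F None (fst y - (\<Sum>k\<in>UNIV. X $ k), snd y - (\<Sum>k\<in>UNIV. T $ k)) \<partial>(lborel \<Otimes>\<^sub>M lborel))"
proof -
  let ?P = "\<Pi>\<^sub>M k\<in>(UNIV :: 'm set). lborel :: ('b \<times> 'c) measure"
  let ?f = "\<lambda>x. (\<Prod>k\<in>UNIV. F (Some k) (x k)) * F None (y - (\<Sum>k\<in>UNIV. x k))"
  let ?r = "\<lambda>x. (\<chi> k. fst (x k), \<chi> k. snd (x k)) :: ('b ^ 'm) \<times> ('c ^ 'm)"
  let ?h = "\<lambda>(X, T). (\<Prod>k\<in>UNIV. F (Some k) (X $ k, T $ k)) *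
       F None (fst y - (\<Sum>k\<in>UNIV. X $ k), snd y - (\<Sum>k\<in>UNIV. T $ k))"
  have f: "?f \<in> borel_measurable ?P"
    by measurable
  have r: "?r \<in> measurable ?P borel"
    by measurable
  have h: "?h \<in> borel_measurable borel"
    unfolding case_prod_unfold by measurable
  have "nfold_convolution F y = (\<integral>\<^sup>+x. ?f x \<partial>?P)"
    unfolding nfold_convolution_def by (rule nn_integral_PiM_lebesgue[OF f])
  also have "\<dots> = (\<integral>\<^sup>+x. ?h (?r x) \<partial>?P)"
  proof (intro nn_integral_cong)
    fix x :: "'m \<Rightarrow> 'b \<times> 'c"
    have "(fst y - (\<Sum>k\<in>UNIV. fst (x k)), snd y - (\<Sum>k\<in>UNIV. snd (x k))) = y - (\<Sum>k\<in>UNIV. x k)"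
      by (simp add: prod_eq_iff fst_sum snd_sum)
    then show "?f x = ?h (?r x)" by simp
  qed
  also have "\<dots> = (\<integral>\<^sup>+p. ?h p \<partial>distr ?P borel ?r)"
    using h by (intro nn_integral_distr[OF r, symmetric]) simp
  finally show ?thesis
    by (simp add: distr_PiM_pair_lborel lborel_prod)
qed

text \<open>The terms \<open>X $ k \<bullet> v\<close> cancel against the last factor of the
  convolution. Hence \<open>X\<close> is paired only with \<open>\<eta>\<close> and \<open>T\<close>
  only with the phase differences, while \<open>y'\<close> and \<open>s\<close> are confined to a
  separate summand.\<close>

lemma phase_sum:
  fixes X \<eta> :: "(real ^ 'm) ^ 'm::finite" and T v :: "real ^ 'm"
  shows "(y' - (\<Sum>k\<in>UNIV. X $ k)) \<bullet> v + (s - (\<Sum>k\<in>UNIV. T $ k)) * \<phi> None v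
      + (\<Sum>k\<in>UNIV. X $ k \<bullet> (\<eta> $ k + v) + T $ k * \<phi> (Some k) (\<eta> $ k + v))
    = X \<bullet> \<eta> + T \<bullet> phase_differences \<phi> \<eta> v + (y' \<bullet> v + s * \<phi> None v)"
proof -
  have 1: "X \<bullet> \<eta> = (\<Sum>k\<in>UNIV. X $ k \<bullet> \<eta> $ k)"
    by (simp add: inner_vec_def)
  have 2: "T \<bullet> phase_differences \<phi> \<eta> v = (\<Sum>k\<in>UNIV. T $ k * \<phi> (Some k) (\<eta> $ k + v)) - (\<Sum>k\<in>UNIV. T $ k) * \<phi> None v"
    by (simp add: inner_vec_def phase_differences_def right_diff_distrib sum_subtractf sum_distrib_right)
  show ?thesis
    unfolding 1 2 by (simp add: inner_add_right inner_diff_left left_diff_distrib sum.distrib inner_sum_left)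
qed

lemma borel_measurable_phase_differences [measurable (raw)]:
  assumes "\<And>j. smooth (\<phi> j)" and [measurable]: "f \<in> borel_measurable M" "h \<in> borel_measurable M"
  shows "(\<lambda>x. phase_differences \<phi> (f x) (h x)) \<in> borel_measurable M"
proof -
  have [measurable]: "\<phi> j \<in> borel_measurable borel" for j
    using assms(1) by (rule smooth_imp_borel)
  show ?thesis
    unfolding phase_differences_def by measurable
qed

lemma has_derivative_phase_differences:
  assumes "\<And>j. smooth (\<phi> j)"
  shows "(phase_differences \<phi> \<eta> has_derivative
    (\<lambda>w. \<chi> k. frechet_derivative (\<phi> (Some k)) (at (\<eta> $ k + v)) w - frechet_derivative (\<phi> None) (at v) w)) (at v)"
proof -
  have "((\<lambda>v. \<phi> (Some k) (\<eta> $ k + v)) has_derivative frechet_derivative (\<phi> (Some k)) (at (\<eta> $ k + v))) (at v)" for k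
  proof -
    have "((\<lambda>v. \<eta> $ k + v) has_derivative (\<lambda>w. w)) (at v)"
      by (auto intro!: derivative_eq_intros)
    from diff_chain_at[OF this smooth_imp_has_derivative[OF assms]]
    show ?thesis by (simp add: o_def)
  qed
  then have "((\<lambda>v. \<phi> (Some k) (\<eta> $ k + v) - \<phi> None v) has_derivative
      (\<lambda>w. frechet_derivative (\<phi> (Some k)) (at (\<eta> $ k + v)) w - frechet_derivative (\<phi> None) (at v) w)) (at v)" for k
    using smooth_imp_has_derivative[OF assms] by (intro has_derivative_diff)
  then show ?thesis
    unfolding phase_differences_def[abs_def]
    by (subst has_derivative_componentwise_within) (auto simp: Basis_vec_def inner_axis)
qed

text \<open>Passing from \<open>v\<close> to \<open>v'\<close> moves all frequencies by the same
  \<open>v' - v\<close>, and equal phase differences force every phase to change by as much as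
  \<open>\<phi> None\<close>. So \<open>common_displacement_eq_0\<close> applies.\<close>

lemma inj_on_phase_differences:
  fixes \<phi> :: "'m::finite option \<Rightarrow> real ^ 'm \<Rightarrow> real"
  assumes smooth: "\<And>j. smooth (\<phi> j)"
    and C: "\<And>j. convex (C j)"
    and det: "\<And>\<zeta>. (\<forall>j. \<zeta> j \<in> C j) \<Longrightarrow> det (gradient_matrix \<phi> \<zeta>) \<noteq> 0"
  shows "inj_on (phase_differences \<phi> \<eta>) {v. \<forall>j. shear (\<eta>, v) j \<in> C j}"
proof (rule inj_onI)
  fix v v' assume v: "v \<in> {v. \<forall>j. shear (\<eta>, v) j \<in> C j}" and v': "v' \<in> {v. \<forall>j. shear (\<eta>, v) j \<in> C j}"
    and eq: "phase_differences \<phi> \<eta> v = phase_differences \<phi> \<eta> v'"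
  have sh: "shear (\<eta>, v) j + (v' - v) = shear (\<eta>, v') j" for j
    by (cases j) simp_all
  have "v' - v = 0"
  proof (rule common_displacement_eq_0[OF smooth det C])
    fix j
    show "shear (\<eta>, v) j \<in> C j" "shear (\<eta>, v) j + (v' - v) \<in> C j"
      using v v' unfolding sh by auto
    show "\<phi> j (shear (\<eta>, v) j + (v' - v)) - \<phi> j (shear (\<eta>, v) j) = \<phi> None v' - \<phi> None v"
    proof (cases j)
      case (Some k)
      have "phase_differences \<phi> \<eta> v $ k = phase_differences \<phi> \<eta> v' $ k"
        using eq by simp
      then show ?thesis
        unfolding sh Some by (simp add: phase_differences_def)
    qed (simp add: sh)
  qed auto
  then show "v = v'" by simp
qed

text \<open>Borel functions that vanish pointwise outside convex sets allow the determinant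
  condition to be used wherever the integrand is nonzero; the theorem is later instantiated with the
  hulls of the essential supports.\<close>

theorem nfold_convolution_extension:
  fixes \<phi> :: "'m::finite option \<Rightarrow> real ^ 'm \<Rightarrow> real" and g :: "'m option \<Rightarrow> real ^ 'm \<Rightarrow> complex"
  assumes smooth: "\<And>j. smooth (\<phi> j)"
    and g: "\<And>j. integrable lborel (g j)"
    and C: "\<And>j. convex (C j)" "\<And>j x. g j x \<noteq> 0 \<Longrightarrow> x \<in> C j"
    and det: "\<And>\<zeta>. (\<forall>j. \<zeta> j \<in> C j) \<Longrightarrow> det (gradient_matrix \<phi> \<zeta>) \<noteq> 0"
  shows "nfold_convolution (\<lambda>j x. ennreal ((cmod (extension (\<phi> j) (g j) x))\<^sup>2)) y =
    ennreal ((2 * pi) ^ (CARD('m option) * CARD('m))) *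
    (\<integral>\<^sup>+\<xi>. ennreal ((cmod (\<Prod>j\<in>UNIV. g j (\<xi> j)))\<^sup>2 / \<bar>det (gradient_matrix \<phi> \<xi>)\<bar>) \<partial>(\<Pi>\<^sub>M j\<in>UNIV. lborel))"
proof -
  let ?L = "lborel :: ((real ^ 'm) ^ 'm) measure" and ?K = "lborel :: (real ^ 'm) measure"
  let ?P = "\<Pi>\<^sub>M j\<in>(UNIV :: 'm option set). ?K"
  have [measurable]: "\<phi> j \<in> borel_measurable borel" for j
    using smooth by (rule smooth_imp_borel)
  have [measurable]: "g j \<in> borel_measurable borel" for j
    using g[of j] by (auto dest: borel_measurable_integrable)
  obtain y' s where y: "y = (y', s)" by (cases y)
  \<comment> \<open>The point \<open>y\<close> enters only here, through a factor of modulus 1,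
    which \<open>norm_G\<close> discards at the end.\<close>
  define G where "G = (\<lambda>p. cis (y' \<bullet> snd p + s * \<phi> None (snd p)) * (\<Prod>j\<in>UNIV. g j (shear p j)))"
  have norm_G: "cmod (G p) = cmod (\<Prod>j\<in>UNIV. g j (shear p j))" for p
    by (simp add: G_def norm_mult)
  have shear_j [measurable]: "(\<lambda>p. shear p j) \<in> borel_measurable (borel :: (((real ^ 'm) ^ 'm) \<times> (real ^ 'm)) measure)" for j
    using measurable_compose[OF measurable_shear measurable_component_singleton[of j UNIV "\<lambda>_. lborel"]] by simp
  have [measurable]: "G \<in> borel_measurable borel"
    unfolding G_def by measurable
  have shear_integral:
    "integrable lborel (\<lambda>p. f (shear p)) \<and> (\<integral>p. f (shear p) \<partial>lborel) = (\<integral>\<xi>. f \<xi> \<partial>?P)"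
    if "integrable ?P f" for f :: "('m option \<Rightarrow> real ^ 'm) \<Rightarrow> complex"
  proof
    have f: "f \<in> borel_measurable ?P"
      using that by (rule borel_measurable_integrable)
    show "integrable lborel (\<lambda>p. f (shear p))"
      using that f integrable_distr_eq[of shear lborel ?P f] by (simp add: distr_shear)
    show "(\<integral>p. f (shear p) \<partial>lborel) = (\<integral>\<xi>. f \<xi> \<partial>?P)"
      using integral_distr[of shear lborel ?P f] f by (simp add: distr_shear)
  qed
  have G_int: "integrable (?L \<Otimes>\<^sub>M ?K) G"
  proof -
    have "integrable ?P (\<lambda>\<xi>. \<Prod>j\<in>UNIV. g j (\<xi> j))"
      by (rule lborel_product.product_integrable_prod) (auto simp: g)
    then have "integrable lborel (\<lambda>p. \<Prod>j\<in>UNIV. g j (shear p j) :: complex)"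
      using shear_integral[of "\<lambda>\<xi>. \<Prod>j\<in>UNIV. g j (\<xi> j)"] by simp
    then have "integrable lborel G"
      unfolding G_def by (rule integrable_cis_mult) measurable
    then show ?thesis by (simp add: lborel_prod)
  qed
  have W_meas [measurable]: "(\<lambda>p. phase_differences \<phi> (fst p) (snd p)) \<in> borel_measurable borel"
    by (intro borel_measurable_phase_differences smooth) measurable
  \<comment> \<open>For fixed \<open>T\<close> this is the function of \<open>\<eta>\<close> whose
    Fourier transform at \<open>X\<close> is the product of the extensions. Fubini makes it
    integrable for every \<open>T\<close>, as \<open>plancherel\<close> requires.\<close>
  define H where "H = (\<lambda>T \<eta>. \<integral>v. cis (T \<bullet> phase_differences \<phi> \<eta> v) * G (\<eta>, v) \<partial>?K)"
  have W2 [measurable]: "(\<lambda>x. phase_differences \<phi> (f x) (h x)) \<in> borel_measurable M"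
    if "f \<in> borel_measurable M" "h \<in> borel_measurable M" for f h and M :: "'x measure"
    using that by (intro borel_measurable_phase_differences smooth)
  have TG_int: "integrable (?L \<Otimes>\<^sub>M ?K) (\<lambda>p. cis (T \<bullet> phase_differences \<phi> (fst p) (snd p)) * G p)" for T
  proof (rule integrable_cis_mult[OF G_int])
    show "(\<lambda>p. T \<bullet> phase_differences \<phi> (fst p) (snd p)) \<in> borel_measurable (?L \<Otimes>\<^sub>M ?K)"
      unfolding lborel_prod by measurable
  qed
  have H_int: "integrable lborel (H T)" for T
    using lborel_pair.integrable_fst'[OF TG_int[of T]] by (simp add: H_def)
  have wave: "(\<Prod>k\<in>UNIV. extension (\<phi> (Some k)) (g (Some k)) (X $ k, T $ k)) *
      extension (\<phi> None) (g None) (y' - (\<Sum>k\<in>UNIV. X $ k), s - (\<Sum>k\<in>UNIV. T $ k)) = fourier (H T) X" for X T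
  proof -
    \<comment> \<open>The arguments of the n factors; the last one completes the sum to
      \<open>(y', s)\<close>.\<close>
    define x where "x = (\<lambda>j. case j of None \<Rightarrow> (y' - (\<Sum>k\<in>UNIV. X $ k), s - (\<Sum>k\<in>UNIV. T $ k)) | Some k \<Rightarrow> (X $ k, T $ k))"
    let ?e = "\<lambda>j \<xi>. cis (fst (x j) \<bullet> \<xi> + snd (x j) * \<phi> j \<xi>) * g j \<xi>"
    have e: "integrable lborel (?e j)" for j
      by (rule integrable_cis_mult[OF g]) measurable
    have e_prod: "integrable ?P (\<lambda>\<xi>. \<Prod>j\<in>UNIV. ?e j (\<xi> j))"
      by (rule lborel_product.product_integrable_prod) (auto simp: e)
    have shear_e: "(\<Prod>j\<in>UNIV. ?e j (shear p j)) = cis (X \<bullet> fst p) * (cis (T \<bullet> phase_differences \<phi> (fst p) (snd p)) * G p)" for p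
    proof -
      have "(\<Prod>j\<in>UNIV. ?e j (shear p j)) = cis (\<Sum>j\<in>UNIV. fst (x j) \<bullet> shear p j + snd (x j) * \<phi> j (shear p j)) * (\<Prod>j\<in>UNIV. g j (shear p j))"
        by (simp add: prod.distrib cis_sum)
      also have "(\<Sum>j\<in>UNIV. fst (x j) \<bullet> shear p j + snd (x j) * \<phi> j (shear p j)) =
          X \<bullet> fst p + T \<bullet> phase_differences \<phi> (fst p) (snd p) + (y' \<bullet> snd p + s * \<phi> None (snd p))"
        unfolding phase_sum[symmetric] UNIV_option_conv
        by (subst sum.insert) (auto simp: sum.reindex x_def)
      finally show ?thesis
        by (simp add: G_def cis_mult[symmetric])
    qed
    have "(\<Prod>k\<in>UNIV. extension (\<phi> (Some k)) (g (Some k)) (X $ k, T $ k)) *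
      extension (\<phi> None) (g None) (y' - (\<Sum>k\<in>UNIV. X $ k), s - (\<Sum>k\<in>UNIV. T $ k)) = (\<Prod>j\<in>UNIV. \<integral>\<xi>. ?e j \<xi> \<partial>lborel)"
      by (simp add: prod_UNIV_option extension_def x_def mult.commute)
    also have "\<dots> = (\<integral>\<xi>. (\<Prod>j\<in>UNIV. ?e j (\<xi> j)) \<partial>?P)"
      by (rule lborel_product.product_integral_prod[symmetric]) (auto simp: e)
    also have "\<dots> = (\<integral>p. (\<Prod>j\<in>UNIV. ?e j (shear p j)) \<partial>lborel)"
      using shear_integral[OF e_prod] by simp
    also have "\<dots> = (\<integral>p. cis (X \<bullet> fst p) * (cis (T \<bullet> phase_differences \<phi> (fst p) (snd p)) * G p) \<partial>(?L \<Otimes>\<^sub>M ?K))"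
      unfolding shear_e lborel_prod ..
    also have "\<dots> = (\<integral>\<eta>. \<integral>v. cis (X \<bullet> \<eta>) * (cis (T \<bullet> phase_differences \<phi> \<eta> v) * G (\<eta>, v)) \<partial>?K \<partial>?L)"
    proof -
      have "integrable (?L \<Otimes>\<^sub>M ?K) (\<lambda>p. cis (X \<bullet> fst p) * (cis (T \<bullet> phase_differences \<phi> (fst p) (snd p)) * G p))"
        by (rule integrable_cis_mult[OF TG_int]) measurable
      from lborel_pair.integral_fst'[OF this] show ?thesis by simp
    qed
    also have "\<dots> = fourier (H T) X"
      unfolding fourier_def H_def integral_mult_right_zero ..
    finally show ?thesis .
  qed
  \<comment> \<open>Joint measurability in \<open>\<eta>\<close> and \<open>T\<close> is required
    for the exchange between the two uses of Plancherel.\<close>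
  have H_meas: "(\<lambda>(\<eta>, T). H T \<eta>) \<in> borel_measurable (?L \<Otimes>\<^sub>M ?K)"
  proof -
    have "(\<lambda>(p, v). cis (snd p \<bullet> phase_differences \<phi> (fst p) v) * G (fst p, v)) \<in> borel_measurable ((?L \<Otimes>\<^sub>M ?K) \<Otimes>\<^sub>M ?K)"
      unfolding case_prod_unfold by measurable
    from lborel.borel_measurable_lebesgue_integral[OF this]
    show ?thesis by (simp add: H_def case_prod_unfold)
  qed
  have F_meas: "(\<lambda>(X, T). fourier (H T) X) \<in> borel_measurable (?L \<Otimes>\<^sub>M ?K)"
  proof -
    have [measurable]: "(\<lambda>x. H (f x) (h x)) \<in> borel_measurable M" if "f \<in> borel_measurable M" "h \<in> borel_measurable M"
      for f h and M :: "((((real ^ 'm) ^ 'm) \<times> (real ^ 'm)) \<times> ((real ^ 'm) ^ 'm)) measure"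
    proof -
      have "(\<lambda>x. (h x, f x)) \<in> measurable M (?L \<Otimes>\<^sub>M ?K)"
        using that by (intro measurable_Pair) auto
      from measurable_compose[OF this H_meas] show ?thesis by simp
    qed
    have "(\<lambda>(p, \<eta>). cis (fst p \<bullet> \<eta>) * H (snd p) \<eta>) \<in> borel_measurable ((?L \<Otimes>\<^sub>M ?K) \<Otimes>\<^sub>M ?L)"
      unfolding case_prod_unfold by measurable
    from lborel.borel_measurable_lebesgue_integral[OF this]
    show ?thesis by (simp add: fourier_def case_prod_unfold)
  qed
  let ?c1 = "ennreal ((2 * pi) ^ (CARD('m) * CARD('m)))" and ?c2 = "ennreal ((2 * pi) ^ CARD('m))"
  define D where "D = (\<lambda>p. det (gradient_matrix \<phi> (shear p)))"
  have D_meas [measurable]: "D \<in> borel_measurable borel"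
    unfolding D_def by (rule measurable_compose[OF measurable_shear borel_measurable_det_gradient_matrix[OF smooth]])
  have H2_meas: "(\<lambda>(\<eta>, T). ennreal ((cmod (H T \<eta>))\<^sup>2)) \<in> borel_measurable (?L \<Otimes>\<^sub>M ?K)"
    using H_meas unfolding case_prod_unfold by measurable
  have q_meas: "(\<lambda>(\<eta>, v). ennreal ((cmod (G (\<eta>, v)))\<^sup>2 / \<bar>D (\<eta>, v)\<bar>)) \<in> borel_measurable (?L \<Otimes>\<^sub>M ?K)"
    unfolding lborel_prod case_prod_unfold by measurable
  have "nfold_convolution (\<lambda>j x. ennreal ((cmod (extension (\<phi> j) (g j) x))\<^sup>2)) y =
      (\<integral>\<^sup>+(X, T). ennreal ((cmod (fourier (H T) X))\<^sup>2) \<partial>(?L \<Otimes>\<^sub>M ?K))"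
    by (subst nfold_convolution_eq_lborel)
       (simp_all add: y wave[symmetric] norm_mult power_mult_distrib ennreal_mult prod_ennreal prod_norm[symmetric] prod_power_distrib[symmetric])
  also have "\<dots> = (\<integral>\<^sup>+T. \<integral>\<^sup>+X. ennreal ((cmod (fourier (H T) X))\<^sup>2) \<partial>?L \<partial>?K)"
  proof -
    have "(\<lambda>(X, T). ennreal ((cmod (fourier (H T) X))\<^sup>2)) \<in> borel_measurable (?L \<Otimes>\<^sub>M ?K)"
      using F_meas unfolding case_prod_unfold by measurable
    from lborel_pair.nn_integral_snd[OF this] show ?thesis by simp
  qed
  also have "\<dots> = (\<integral>\<^sup>+T. ?c1 * (\<integral>\<^sup>+\<eta>. ennreal ((cmod (H T \<eta>))\<^sup>2) \<partial>?L) \<partial>?K)"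
    by (simp add: plancherel[OF H_int])
  also have "\<dots> = ?c1 * (\<integral>\<^sup>+T. \<integral>\<^sup>+\<eta>. ennreal ((cmod (H T \<eta>))\<^sup>2) \<partial>?L \<partial>?K)"
    using lborel.borel_measurable_nn_integral[OF measurable_pair_swap[OF H2_meas]] by (intro nn_integral_cmult) simp
  \<comment> \<open>The second use of Plancherel runs over \<open>T\<close> at fixed
    \<open>\<eta>\<close>, so \<open>T\<close> must become the inner variable.\<close>
  also have "(\<integral>\<^sup>+T. \<integral>\<^sup>+\<eta>. ennreal ((cmod (H T \<eta>))\<^sup>2) \<partial>?L \<partial>?K) = (\<integral>\<^sup>+\<eta>. \<integral>\<^sup>+T. ennreal ((cmod (H T \<eta>))\<^sup>2) \<partial>?K \<partial>?L)"
    by (rule lborel_pair.Fubini'[OF H2_meas])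
  also have "\<dots> = (\<integral>\<^sup>+\<eta>. ?c2 * (\<integral>\<^sup>+v. ennreal ((cmod (G (\<eta>, v)))\<^sup>2 / \<bar>D (\<eta>, v)\<bar>) \<partial>?K) \<partial>?L)"
  \<comment> \<open>Fubini gives integrability of the slice of \<open>G\<close> at
    \<open>\<eta>\<close> only almost everywhere.\<close>
  proof (rule nn_integral_cong_AE)
    show "AE \<eta> in ?L. (\<integral>\<^sup>+T. ennreal ((cmod (H T \<eta>))\<^sup>2) \<partial>?K) = ?c2 * (\<integral>\<^sup>+v. ennreal ((cmod (G (\<eta>, v)))\<^sup>2 / \<bar>D (\<eta>, v)\<bar>) \<partial>?K)"
      using lborel_pair.AE_integrable_fst'[OF G_int]
    proof eventually_elim
      case (elim \<eta>)
      have G_C: "shear (\<eta>, v) j \<in> C j" if "G (\<eta>, v) \<noteq> 0" for v j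
        using that C(2)[of j "shear (\<eta>, v) j"] by (auto simp: G_def)
      show ?case
        unfolding H_def
      proof (rule plancherel_oscillatory_finite[OF elim])
        show "phase_differences \<phi> \<eta> \<in> borel_measurable borel"
          by measurable
        show "(phase_differences \<phi> \<eta> has_derivative
            (\<lambda>w. \<chi> k. frechet_derivative (\<phi> (Some k)) (at (\<eta> $ k + v)) w - frechet_derivative (\<phi> None) (at v) w)) (at v)" for v
          by (rule has_derivative_phase_differences[OF smooth])
        show "inj_on (phase_differences \<phi> \<eta>) {v. G (\<eta>, v) \<noteq> 0}"
          by (rule inj_on_subset[OF inj_on_phase_differences[OF smooth C(1) det]]) (use G_C in auto)
        show "(\<lambda>v. D (\<eta>, v)) \<in> borel_measurable borel"
          by measurable
        show "\<bar>det (\<chi> i j :: 'm wellordered. (\<chi> k. frechet_derivative (\<phi> (Some k)) (at (\<eta> $ k + v)) (axis (un_WO j) 1)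
            - frechet_derivative (\<phi> None) (at v) (axis (un_WO j) 1)) $ un_WO i)\<bar> = \<bar>D (\<eta>, v)\<bar>" for v
          by (simp add: D_def det_gradient_matrix_reduce gradient_def)
        show "D (\<eta>, v) \<noteq> 0" if "G (\<eta>, v) \<noteq> 0" for v
          unfolding D_def by (rule det) (use G_C[OF that] in auto)
      qed
    qed
  qed
  also have "\<dots> = ?c2 * (\<integral>\<^sup>+\<eta>. \<integral>\<^sup>+v. ennreal ((cmod (G (\<eta>, v)))\<^sup>2 / \<bar>D (\<eta>, v)\<bar>) \<partial>?K \<partial>?L)"
    using lborel.borel_measurable_nn_integral[OF q_meas] by (intro nn_integral_cmult) simp
  also have "(\<integral>\<^sup>+\<eta>. \<integral>\<^sup>+v. ennreal ((cmod (G (\<eta>, v)))\<^sup>2 / \<bar>D (\<eta>, v)\<bar>) \<partial>?K \<partial>?L) =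
      (\<integral>\<^sup>+p. ennreal ((cmod (G p))\<^sup>2 / \<bar>D p\<bar>) \<partial>lborel)"
    using lborel.nn_integral_fst[OF q_meas] by (simp add: lborel_prod case_prod_unfold)
  also have "\<dots> = (\<integral>\<^sup>+\<xi>. ennreal ((cmod (\<Prod>j\<in>UNIV. g j (\<xi> j)))\<^sup>2 / \<bar>det (gradient_matrix \<phi> \<xi>)\<bar>) \<partial>?P)"
  proof -
    have sm: "shear \<in> measurable lborel ?P"
      by simp
    have f: "(\<lambda>\<xi>. ennreal ((cmod (\<Prod>j\<in>UNIV. g j (\<xi> j)))\<^sup>2 / \<bar>det (gradient_matrix \<phi> \<xi>)\<bar>)) \<in> borel_measurable ?P"
      using borel_measurable_det_gradient_matrix[OF smooth] by measurable
    have "(\<integral>\<^sup>+p. ennreal ((cmod (G p))\<^sup>2 / \<bar>D p\<bar>) \<partial>lborel) =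
        (\<integral>\<^sup>+\<xi>. ennreal ((cmod (\<Prod>j\<in>UNIV. g j (\<xi> j)))\<^sup>2 / \<bar>det (gradient_matrix \<phi> \<xi>)\<bar>) \<partial>distr lborel ?P shear)"
      unfolding norm_G D_def by (rule nn_integral_distr[OF sm, symmetric]) (use f in simp)
    then show ?thesis by (simp only: distr_shear)
  qed
  finally have "nfold_convolution (\<lambda>j x. ennreal ((cmod (extension (\<phi> j) (g j) x))\<^sup>2)) y = ?c1 * (?c2 *
      (\<integral>\<^sup>+\<xi>. ennreal ((cmod (\<Prod>j\<in>UNIV. g j (\<xi> j)))\<^sup>2 / \<bar>det (gradient_matrix \<phi> \<xi>)\<bar>) \<partial>?P))" .
  moreover have "CARD('m option) = Suc (CARD('m))"
    by (simp add: UNIV_option_conv card_image del: card_option)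
  \<comment> \<open>With m = n - 1 the exponents m * m and m add up to (m + 1) * m.\<close>
  then have "?c1 * ?c2 = ennreal ((2 * pi) ^ (CARD('m option) * CARD('m)))"
    by (simp add: ennreal_mult[symmetric] power_add)
  ultimately show ?thesis
    by (simp only: mult.assoc[symmetric])
qed

section \<open>Essential supports and Borel representatives\<close>

lemma closed_ess_support: "closed (ess_support g)"
  unfolding ess_support_def by (intro closed_Compl open_Union) auto

text \<open>The defining union may be uncountable; by Lindelof a countable subfamily has the same
  union, and countably many null sets form a null set.\<close>

lemma AE_ess_support: "AE x in lebesgue. x \<notin> ess_support g \<longrightarrow> g x = 0"
proof -
  let ?U = "{U. open U \<and> (AE x in lebesgue. x \<in> U \<longrightarrow> g x = 0)}"
  obtain V where V: "V \<subseteq> ?U" "countable V" "\<Union>V = \<Union>?U"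
    using Lindelof[of ?U] by blast
  have "\<forall>U\<in>V. AE x in lebesgue. x \<in> U \<longrightarrow> g x = 0"
    using V(1) by blast
  then have "AE x in lebesgue. \<forall>U\<in>V. x \<in> U \<longrightarrow> g x = 0"
    using V(2) by (subst AE_ball_countable) auto
  then show ?thesis
    by eventually_elim (use V(3) in \<open>auto simp: ess_support_def\<close>)
qed

lemma extension_operator_eq_extension:
  assumes "smooth \<phi>" and g: "integrable lborel g'" and ae: "AE \<xi> in lebesgue. g \<xi> = g' \<xi>"
    and gl: "integrable lebesgue g"
  shows "extension_operator \<phi> g = extension \<phi> g'"
proof
  fix x
  have [measurable]: "\<phi> \<in> borel_measurable borel"
    using assms(1) by (rule smooth_imp_borel)
  have [measurable]: "g' \<in> borel_measurable borel"
    using g by (auto dest: borel_measurable_integrable)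
  let ?c = "\<lambda>\<xi>. cis (fst x \<bullet> \<xi> + snd x * \<phi> \<xi>)"
  have c: "?c \<in> borel_measurable lborel" by measurable
  have "extension_operator \<phi> g x = (\<integral>\<xi>. ?c \<xi> * g \<xi> \<partial>lebesgue)"
    by (simp add: extension_operator_def cis_conv_exp)
  also have "\<dots> = (\<integral>\<xi>. ?c \<xi> * g' \<xi> \<partial>lebesgue)"
  proof (rule integral_cong_AE)
    show "(\<lambda>\<xi>. ?c \<xi> * g \<xi>) \<in> borel_measurable lebesgue"
      by (intro borel_measurable_times measurable_completion[OF c] borel_measurable_integrable[OF gl])
    show "(\<lambda>\<xi>. ?c \<xi> * g' \<xi>) \<in> borel_measurable lebesgue"
      by (rule measurable_completion) measurable
    show "AE \<xi> in lebesgue. ?c \<xi> * g \<xi> = ?c \<xi> * g' \<xi>"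
      using ae by eventually_elim simp
  qed
  also have "\<dots> = extension \<phi> g' x"
    unfolding extension_def by (rule integral_completion) measurable
  finally show "extension_operator \<phi> g x = extension \<phi> g' x" .
qed

text \<open>Cutting off at the closed essential support changes the function only on a null set and
  turns almost everywhere vanishing into pointwise vanishing, as
  \<open>nfold_convolution_extension\<close> demands.\<close>

lemma ex_borel_representative:
  assumes "integrable lebesgue g"
  shows "\<exists>g'. integrable lborel g' \<and> (AE x in lebesgue. g x = g' x) \<and> (\<forall>x. g' x \<noteq> 0 \<longrightarrow> x \<in> ess_support g)"
proof -
  obtain f where f: "integrable lborel f" "AE x in lborel. g x = f x"
    using integrable_lebesgue_ex_borel[OF assms] .
  let ?g = "\<lambda>x. indicator (ess_support g) x *\<^sub>R f x"
  have "integrable lborel ?g"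
    using f(1) by (rule integrable_mult_indicator[rotated]) (simp add: closed_ess_support borel_closed)
  moreover have "AE x in lebesgue. g x = ?g x"
    using AE_completion[OF f(2)] AE_ess_support[of g] by eventually_elim (auto simp: indicator_def)
  ultimately show ?thesis
    by (intro exI[of _ ?g]) (auto simp: indicator_def)
qed

theorem theorem1p1:
  fixes \<phi> :: "'m::finite option \<Rightarrow> real ^ 'm \<Rightarrow> real"
    and g :: "'m option \<Rightarrow> real ^ 'm \<Rightarrow> complex"
  assumes "\<And>j. smooth (\<phi> j)"
    and "\<And>j. integrable lebesgue (g j)"
    and "\<And>\<xi>. (\<forall>j. \<xi> j \<in> convex hull (ess_support (g j))) \<Longrightarrow> det (gradient_matrix \<phi> \<xi>) \<noteq> 0"
  shows "nfold_convolution (\<lambda>j x. ennreal ((cmod (extension_operator (\<phi> j) (g j) x))\<^sup>2)) constant_on UNIV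
    \<and> (\<forall>y. nfold_convolution (\<lambda>j x. ennreal ((cmod (extension_operator (\<phi> j) (g j) x))\<^sup>2)) y =
      ennreal ((2 * pi) ^ (CARD('m option) * CARD('m))) *
      (\<integral>\<^sup>+ \<xi>. (if \<exists>j. g j (\<xi> j) = 0 then 0
             else (\<Prod>j\<in>UNIV. ennreal ((cmod (g j (\<xi> j)))\<^sup>2)) / ennreal \<bar>det (gradient_matrix \<phi> \<xi>)\<bar>)
         \<partial>(\<Pi>\<^sub>M j\<in>(UNIV :: 'm option set). lebesgue)))"
proof -
  let ?L = "\<Pi>\<^sub>M j\<in>(UNIV :: 'm option set). lebesgue :: (real ^ 'm) measure"
  obtain h where h: "\<And>j. integrable lborel (h j)" "\<And>j. AE x in lebesgue. g j x = h j x"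
    "\<And>j x. h j x \<noteq> 0 \<Longrightarrow> x \<in> ess_support (g j)"
    using ex_borel_representative[OF assms(2)] by metis
  have [measurable]: "h j \<in> borel_measurable borel" for j
    using h(1)[of j] by (auto dest: borel_measurable_integrable)
  have hull: "h j x \<noteq> 0 \<Longrightarrow> x \<in> convex hull (ess_support (g j))" for j x
    by (rule hull_inc) (rule h(3))
  have ext: "extension_operator (\<phi> j) (g j) = extension (\<phi> j) (h j)" for j
    by (rule extension_operator_eq_extension[OF assms(1) h(1,2) assms(2)])
  let ?I = "\<lambda>\<xi>. ennreal ((cmod (\<Prod>j\<in>UNIV. h j (\<xi> j)))\<^sup>2 / \<bar>det (gradient_matrix \<phi> \<xi>)\<bar>)"
  let ?R = "\<lambda>\<xi>. if \<exists>j. g j (\<xi> j) = 0 then 0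
      else (\<Prod>j\<in>UNIV. ennreal ((cmod (g j (\<xi> j)))\<^sup>2)) / ennreal \<bar>det (gradient_matrix \<phi> \<xi>)\<bar>"
  have "(\<integral>\<^sup>+\<xi>. ?R \<xi> \<partial>?L) = (\<integral>\<^sup>+\<xi>. ?I \<xi> \<partial>?L)"
  proof (rule nn_integral_cong_AE)
    show "AE \<xi> in ?L. ?R \<xi> = ?I \<xi>"
      using AE_PiM_lebesgue[of "\<lambda>j x. g j x = h j x", OF h(2)]
    proof eventually_elim
      case (elim \<xi>)
      show ?case
      \<comment> \<open>The two integrands divide in \<open>ennreal\<close> and in the reals, which
        disagree at a zero determinant. If some factor vanishes, both are 0 by convention or by the
        numerator; otherwise all \<open>\<xi> j\<close> lie in the hulls and the determinant is
        nonzero.\<close>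
      proof (cases "\<exists>j. h j (\<xi> j) = 0")
        case True
        then have "(\<Prod>j\<in>UNIV. h j (\<xi> j)) = 0"
          by (intro prod_zero) auto
        with True elim show ?thesis by simp
      next
        case False
        then have "det (gradient_matrix \<phi> \<xi>) \<noteq> 0"
          by (intro assms(3)) (auto intro: hull)
        moreover have "(\<Prod>j\<in>UNIV. ennreal ((cmod (h j (\<xi> j)))\<^sup>2)) = ennreal ((cmod (\<Prod>j\<in>UNIV. h j (\<xi> j)))\<^sup>2)"
          by (simp add: prod_ennreal prod_norm[symmetric] prod_power_distrib)
        ultimately show ?thesis
          using False elim by (simp add: divide_ennreal)
      qed
    qed
  qed
  also have "\<dots> = (\<integral>\<^sup>+\<xi>. ?I \<xi> \<partial>(\<Pi>\<^sub>M j\<in>UNIV. lborel))"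
  proof (rule nn_integral_PiM_lebesgue)
    show "?I \<in> borel_measurable (\<Pi>\<^sub>M j\<in>UNIV. lborel)"
      using borel_measurable_det_gradient_matrix[of \<phi>, OF assms(1)] by measurable
  qed
  \<comment> \<open>The value on the right is the same for every \<open>y\<close>, so this identity
    also gives constancy.\<close>
  finally have "nfold_convolution (\<lambda>j x. ennreal ((cmod (extension_operator (\<phi> j) (g j) x))\<^sup>2)) y =
      ennreal ((2 * pi) ^ (CARD('m option) * CARD('m))) * (\<integral>\<^sup>+\<xi>. ?R \<xi> \<partial>?L)" for y
    unfolding ext
    using nfold_convolution_extension[of \<phi> h "\<lambda>j. convex hull (ess_support (g j))" y, OF assms(1) h(1) convex_convex_hull hull assms(3)] by simp
  then show ?thesis
    by (auto simp: constant_on_def)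
qed

end
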